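(* Let $(X,d,\mu)$ be a doubling metric measure space. Suppose there are $q$ and a constant $C=C(X)>0$ such that for every $x\in X$ there exists $r_0=r_0(x)>0$ such that for every $r<r_0$, $$\mu(B(x,r))\le C r^q.$$ Let $\mathcal{E}$ be a family of subsets of $X$ and let $\mathbf{E}=\{\lambda_E\}_{E\in\mathcal{E}}$ be a collection of measures associated to $\mathcal{E}$, where $\lambda_E$ is supported on $E$, such that 1. $\dim_C(E)\ge 1$ for all $E\in\mathcal{E}$; 2. for any $s>1$, $E\in\mathcal{E}$ and $x\in E$ there exist constants $C_1=C_1(\mathcal{E},s)>0$ (depending only on $\mathcal{E}$ and $s$) and $r_1=r_1(\mathcal{E},s,x)>0$ such that for every $r<r_1$, $$\lambda_E(B(x,r)\cap E)\ge C_1 r^s.$$ If $\mathrm{Mod}_p(\mathbf{E})>0$ for some $1\le p<q$, then $\dim_C(X)\ge q$.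
   Context: $B(x,r)$ is the open ball of radius $r$ centered at $x$. The space $(X,d,\mu)$ is doubling if there is a constant $C\ge1$ with $\mu(B(x,r))\le C\mu(B(x,r/2))$ for all $x\in X$, $r>0$. Fuglede modulus: for a family $\mathbf{E}$ of measures on $X$ such that the domain of each $\lambda\in\mathbf{E}$ contains the domain of $\mu$, and $p\ge1$, $\mathrm{Mod}_p(\mathbf{E})=\inf_\rho\int_X\rho^p\,d\mu$, where the infimum is over all Borel functions $\rho:X\to[0,\infty)$ with $\int\rho\,d\lambda\ge1$ for all $\lambda\in\mathbf{E}$. $\dim_H$ denotes Hausdorff dimension. A homeomorphism $f:X\to Y$ between metric spaces is quasisymmetric if there is a homeomorphism $\eta:[0,\infty)\to[0,\infty)$ such that $d_Y(f(x),f(y))/d_Y(f(x),f(z))\le\eta\big(d_X(x,y)/d_X(x,z)\big)$ for all $x,y,z\in X$ with $x\neq z$. The conformal dimension is $\dim_C X=\inf\{\dim_H f(X)\}$ over all quasisymmetric homeomorphisms $f$ of $X$ onto metric spaces. Subsets of $X$ carry the restricted metric.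
   Formalization: In the Fuglede modulus the admissible Borel functions may take the value ∞ (ρ: X→[0,∞]) instead of only finite values [0,∞); with finite-valued ρ the statement is false, e.g. for a suitable family of subsets of an edge of the Sierpinski gasket. *)

theory Defs
  imports "HOL-Analysis.Analysis"
begin

section \<open>Hausdorff dimension of a metric space\<close>

text \<open>
  Only positive exponents \<open>s\<close> are used below, so the value at \<open>s = 0\<close> is irrelevant.
\<close>
definition epowr :: "ennreal \<Rightarrow> real \<Rightarrow> ennreal" where
  "epowr x s = (if x = \<infinity> then \<infinity> else ennreal (enn2real x powr s))"

definition ediam :: "('a \<Rightarrow> 'a \<Rightarrow> real) \<Rightarrow> 'a set \<Rightarrow> ennreal" where
  "ediam d A = (SUP x\<in>A. SUP y\<in>A. ennreal (d x y))"

definition hausdorff_premeasure ::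
    "('a \<Rightarrow> 'a \<Rightarrow> real) \<Rightarrow> real \<Rightarrow> ennreal \<Rightarrow> 'a set \<Rightarrow> ennreal" where
  "hausdorff_premeasure d s \<delta> M =
     (INF A\<in>{A :: nat \<Rightarrow> 'a set. (\<Union>i. A i) = M \<and> (\<forall>i. ediam d (A i) \<le> \<delta>)}.
        \<Sum>i. epowr (ediam d (A i)) s)"

definition hausdorff_measure :: "('a \<Rightarrow> 'a \<Rightarrow> real) \<Rightarrow> real \<Rightarrow> 'a set \<Rightarrow> ennreal" where
  "hausdorff_measure d s M = (SUP \<delta>\<in>{0<..}. hausdorff_premeasure d s \<delta> M)"

text \<open>
  The infimum of the empty set is \<open>\<infinity>\<close>. The empty space gets dimension \<open>0\<close>.
\<close>
definition hausdorff_dim :: "'a set \<Rightarrow> ('a \<Rightarrow> 'a \<Rightarrow> real) \<Rightarrow> ennreal" where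
  "hausdorff_dim M d = Inf {ennreal s | s. 0 < s \<and> hausdorff_measure d s M = 0}"


section \<open>Quasisymmetric maps and conformal dimension\<close>

definition quasisymmetric ::
    "'a set \<Rightarrow> ('a \<Rightarrow> 'a \<Rightarrow> real) \<Rightarrow> 'b set \<Rightarrow> ('b \<Rightarrow> 'b \<Rightarrow> real) \<Rightarrow> ('a \<Rightarrow> 'b) \<Rightarrow> bool" where
  "quasisymmetric M d N e f \<longleftrightarrow>
     homeomorphic_map (Metric_space.mtopology M d) (Metric_space.mtopology N e) f \<and>
     (\<exists>\<eta> \<theta> :: real \<Rightarrow> real. homeomorphism {0..} {0..} \<eta> \<theta> \<and>
        (\<forall>x\<in>M. \<forall>y\<in>M. \<forall>z\<in>M. x \<noteq> z \<longrightarrow>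
           e (f x) (f y) / e (f x) (f z) \<le> \<eta> (d x y / d x z)))"

text \<open>
  The target spaces range over all metric spaces whose points have the same type as those of
  \<open>M\<close>. This is no restriction: every metric space homeomorphic to \<open>M\<close> is isometric to one with
  carrier \<open>M\<close>; see lemma \<open>conformal_dim_le\<close> below, where the target has an arbitrary type.
\<close>
definition conformal_dim :: "'a set \<Rightarrow> ('a \<Rightarrow> 'a \<Rightarrow> real) \<Rightarrow> ennreal" where
  "conformal_dim M d =
     Inf {hausdorff_dim N e | (N :: 'a set) e f.
            Metric_space N e \<and> quasisymmetric M d N e f}"

lemma hausdorff_dim_pullback_le:
  fixes f :: "'a \<Rightarrow> 'b" and M :: "'a set" and N :: "'b set"
  assumes "f ` M = N"
  shows "hausdorff_dim M (\<lambda>x y. e (f x) (f y)) \<le> hausdorff_dim N e"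
proof -
  let ?e = "\<lambda>x y. e (f x) (f y)"
  have diam: "ediam ?e (M \<inter> f -` A) = ediam e A" if "A \<subseteq> N" for A
  proof -
    have A: "A = f ` (M \<inter> f -` A)" using assms that by auto
    show ?thesis unfolding ediam_def by (subst (3 4) A) (simp only: image_image)
  qed
  have pre: "hausdorff_premeasure ?e s \<delta> M \<le> hausdorff_premeasure e s \<delta> N" for s \<delta>
    unfolding hausdorff_premeasure_def
  proof (rule INF_mono, clarify)
    fix A :: "nat \<Rightarrow> 'b set"
    assume A: "N = (\<Union>i. A i)" "\<forall>i. ediam e (A i) \<le> \<delta>"
    then have sub: "A i \<subseteq> N" for i by auto
    have "f x \<in> (\<Union>i. A i)" if "x \<in> M" for x
      unfolding A(1)[symmetric] assms[symmetric] using that by (rule imageI)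
    then have "(\<Union>i. M \<inter> f -` A i) = M" by blast
    then show "\<exists>B\<in>{B. (\<Union>i. B i) = M \<and> (\<forall>i. ediam ?e (B i) \<le> \<delta>)}.
        (\<Sum>i. epowr (ediam ?e (B i)) s) \<le> (\<Sum>i. epowr (ediam e (A i)) s)"
      using A(2) by (intro bexI[of _ "\<lambda>i. M \<inter> f -` A i"]) (simp_all add: diam[OF sub])
  qed
  have "hausdorff_measure ?e s M \<le> hausdorff_measure e s N" for s
    unfolding hausdorff_measure_def by (intro SUP_mono) (use pre in blast)
  then have "hausdorff_measure ?e s M = 0" if "hausdorff_measure e s N = 0" for s
    using that by (metis le_zero_eq)
  then show ?thesis
    unfolding hausdorff_dim_def by (intro Inf_superset_mono) blast
qed

lemma conformal_dim_le:
  fixes M :: "'a set" and N :: "'b set"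
  assumes M: "Metric_space M d" and N: "Metric_space N e" and f: "quasisymmetric M d N e f"
  shows "conformal_dim M d \<le> hausdorff_dim N e"
proof -
  let ?e = "\<lambda>x y. e (f x) (f y)"
  have hf: "homeomorphic_map (Metric_space.mtopology M d) (Metric_space.mtopology N e) f"
    using f by (simp add: quasisymmetric_def)
  have im: "f ` M = N" and inj: "inj_on f M"
    using homeomorphic_imp_surjective_map[OF hf] homeomorphic_imp_injective_map[OF hf]
    by (simp_all add: Metric_space.topspace_mtopology M N)
  have Me: "Metric_space M ?e"
  proof
    fix x y z
    show "0 \<le> ?e x y" "?e x y = ?e y x"
      using N by (simp_all add: Metric_space.nonneg Metric_space.commute)
    show "?e x y = 0 \<longleftrightarrow> x = y" if "x \<in> M" "y \<in> M"
      using that im inj Metric_space.zero[OF N, of "f x" "f y"] by (auto dest: inj_onD)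
    show "?e x z \<le> ?e x y + ?e y z" if "x \<in> M" "y \<in> M" "z \<in> M"
      using that im Metric_space.triangle[OF N, of "f x" "f y" "f z"] by auto
  qed
  have iso: "homeomorphic_map (Metric_space.mtopology M ?e) (Metric_space.mtopology N e) f"
  proof -
    interpret E: Metric_space12 M ?e N e using Me N by (simp add: Metric_space12_def)
    show ?thesis
      using E.isometry_imp_homeomorphic_map[of f] im by simp
  qed
  obtain g where g:
    "homeomorphic_maps (Metric_space.mtopology M ?e) (Metric_space.mtopology N e) f g"
    using iso by (auto simp: homeomorphic_map_maps)
  have "homeomorphic_map (Metric_space.mtopology N e) (Metric_space.mtopology M ?e) g"
    using g homeomorphic_maps_map by blast
  then have "homeomorphic_map (Metric_space.mtopology M d) (Metric_space.mtopology M ?e) (g \<circ> f)"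
    using hf homeomorphic_map_compose by blast
  then have "homeomorphic_map (Metric_space.mtopology M d) (Metric_space.mtopology M ?e) id"
  proof (rule homeomorphic_map_eq)
    fix x assume "x \<in> topspace (Metric_space.mtopology M d)"
    then have "x \<in> topspace (Metric_space.mtopology M ?e)"
      by (simp only: Metric_space.topspace_mtopology[OF M] Metric_space.topspace_mtopology[OF Me])
    then show "(g \<circ> f) x = id x"
      using g by (simp add: homeomorphic_maps_def)
  qed
  then have "quasisymmetric M d M ?e id"
    using f by (simp add: quasisymmetric_def)
  then have "conformal_dim M d \<le> hausdorff_dim M ?e"
    unfolding conformal_dim_def using Me by (intro Inf_lower) auto
  also have "\<dots> \<le> hausdorff_dim N e"
    by (rule hausdorff_dim_pullback_le[OF im])
  finally show ?thesis .
qed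


section \<open>Doubling measures and the Fuglede modulus\<close>

definition doubling_measure :: "'a::metric_space measure \<Rightarrow> bool" where
  "doubling_measure \<mu> \<longleftrightarrow>
     (\<exists>C\<ge>1. \<forall>x. \<forall>r>0. emeasure \<mu> (ball x r) \<le> ennreal C * emeasure \<mu> (ball x (r / 2)))"

text \<open>
  Admissible functions are Borel and may take the value \<open>\<infinity>\<close>, as usual for moduli; this is what
  makes the modulus countably subadditive. With real-valued functions only, a family none of
  whose admissible functions is finite everywhere would get modulus \<open>\<infinity>\<close>, even if an admissible
  function with arbitrarily small \<open>p\<close>-energy exists that is infinite merely on a
  \<open>\<mu>\<close>-null set (such sets may be charged by the measures of the family).
\<close>
definition fuglede_modulus ::
    "real \<Rightarrow> 'a::topological_space measure \<Rightarrow> 'a measure set \<Rightarrow> ennreal" where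
  "fuglede_modulus p \<mu> \<Lambda> =
     (INF \<rho>\<in>{\<rho> :: 'a \<Rightarrow> ennreal. \<rho> \<in> borel_measurable borel \<and>
                (\<forall>\<nu>\<in>\<Lambda>. 1 \<le> (\<integral>\<^sup>+x. \<rho> x \<partial>\<nu>))}.
        \<integral>\<^sup>+x. epowr (\<rho> x) p \<partial>\<mu>)"

end

theory Submission
  imports Defs
begin

text \<open>
  Suppose that some quasisymmetric image of the space has Hausdorff dimension less than \<open>q\<close>. Pulling
  its metric back gives a metric \<open>e\<close> on the space itself, and there is \<open>t < q\<close> such that the space is
  null for the \<open>t\<close>-dimensional measure of \<open>e\<close>. Fix \<open>p'\<close> with \<open>max t p < p' < q\<close>. Quasisymmetry turns a
  cheap cover of the space by sets \<open>A i\<close> into a system of balls \<open>B i\<close> of radius comparable with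
  a dyadic bound \<open>R i\<close> of \<open>diam (A i)\<close>, and of \<open>e\<close>-diameter at most a multiple of \<open>D i\<close>, which is
  slightly larger than the \<open>e\<close>-diameter of \<open>A i\<close>, so that \<open>\<Sum>i. D i powr t\<close> is as small as desired
  (lemma \<open>scaled_cover\<close>). The test function is
  \<open>\<rho> = (\<Sum>i. D i powr t * R i powr - q * indicator (B i)) powr (1 / p')\<close>.

  Its energy \<open>\<integral>\<rho> powr p' d\<mu>\<close> is at most a constant times \<open>\<Sum>i. D i powr t\<close> because \<open>\<mu> (B i)\<close> is at most a
  constant times \<open>R i powr q\<close>. On the other hand, on \<open>B i\<close> the function \<open>\<rho>\<close> is at least
  \<open>D i powr \<alpha> * R i powr - (q / p')\<close> with \<open>\<alpha> = t / p' < 1\<close>. Since \<open>q / p' > 1\<close>, there is \<open>s > 1\<close>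
  below it, and the spare factor \<open>R i powr (q / p' - s)\<close> is summable over the dyadic scales. Hence, up to
  constants, \<open>\<integral>\<rho> d\<lambda>\<close> for the measure \<open>\<lambda>\<close> of \<open>E\<close> is at least
  \<open>\<Sum>i. D i powr \<alpha> * R i powr - s * \<lambda> (B i)\<close> taken over balls that are disjoint within each scale and whose
  multiples cover \<open>E\<close>, which is at least \<open>\<Sum>i. D i powr \<alpha>\<close>, hence at least the \<open>\<alpha>\<close>-dimensional content
  of \<open>E\<close> for \<open>e\<close> (lemma \<open>integral_ge_content\<close>). This content is positive because the conformal
  dimension of \<open>E\<close> exceeds \<open>\<alpha>\<close>.

  The mass bounds are uniform only on the members of a countable exhaustion of the space by bounded
  sets, and the content is bounded below only on the members of a countable decomposition of the
  family. For each such piece the energy can be made arbitrarily small against a fixed lower bound of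
  the integrals (lemma \<open>small_energy_test_functions\<close>), so that the family has modulus zero (lemma
  \<open>fuglede_modulus_eq_0\<close>). The doubling property enters through the finiteness of the measure of
  balls, which allows one to pass from the \<open>p'\<close>-energy to the \<open>p\<close>-energy.
\<close>

section \<open>Powers of extended nonnegative reals\<close>

lemma ennreal_eq_0I:
  assumes "\<And>\<epsilon>. 0 < \<epsilon> \<Longrightarrow> x \<le> ennreal \<epsilon>"
  shows "x = 0"
proof -
  have "x \<le> 0" by (rule ennreal_le_epsilon) (simp add: assms)
  then show ?thesis by simp
qed

lemma le_suminf_ennreal: "f i \<le> (\<Sum>i. f i :: ennreal)"
  using sum_le_suminf[OF summableI, of "{i}" f] by simp

lemma epowr_top [simp]: "epowr top s = top"
  by (simp add: epowr_def)

lemma epowr_ennreal: "0 \<le> x \<Longrightarrow> epowr (ennreal x) s = ennreal (x powr s)"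
  by (simp add: epowr_def)

lemma epowr_0 [simp]: "epowr 0 s = 0"
  by (simp add: epowr_def)

lemma epowr_one [simp]: "epowr x 1 = x"
  by (cases x rule: ennreal_cases) (simp_all add: epowr_ennreal)

lemma epowr_mono:
  assumes "0 \<le> s" "x \<le> y"
  shows "epowr x s \<le> epowr y s"
proof (cases y rule: ennreal_cases)
  case y: (real b)
  show ?thesis
    using assms y
    by (cases x rule: ennreal_cases) (auto simp: epowr_ennreal top_unique intro!: ennreal_leI powr_mono2)
qed simp

lemma epowr_epowr: "epowr (epowr x a) b = epowr x (a * b)"
  by (cases x rule: ennreal_cases) (simp_all add: epowr_ennreal powr_powr)

lemma epowr_cmult:
  assumes "0 < c"
  shows "epowr (ennreal c * x) s = ennreal (c powr s) * epowr x s"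
  using assms
  by (cases x rule: ennreal_cases)
     (simp_all add: epowr_ennreal powr_mult ennreal_mult_top flip: ennreal_mult)

lemma epowr_pos: "0 < x \<Longrightarrow> 0 < epowr x s"
  by (cases x rule: ennreal_cases) (auto simp: epowr_ennreal)

lemma borel_measurable_epowr [measurable]:
  assumes "f \<in> borel_measurable M"
  shows "(\<lambda>x. epowr (f x) s) \<in> borel_measurable M"
  unfolding epowr_def using assms by measurable

lemma borel_measurable_finer:
  assumes f: "f \<in> borel_measurable (borel :: 'a::topological_space measure)"
    and M: "sets (borel :: 'a measure) \<subseteq> sets M"
  shows "f \<in> borel_measurable M"
proof -
  have "UNIV \<in> sets M"
    using M by (metis sets.top space_borel subsetD)
  then have "space M = UNIV"
    using sets.sets_into_space by blast
  then show ?thesis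
    using f M by (auto simp: measurable_def)
qed


section \<open>Families of modulus zero\<close>

text \<open>
  Countable subadditivity of the modulus for exceptional families: a function that is admissible
  for the whole union is the \<open>p\<close>-sum of functions of small energy, one for each part.
  The lower bound for the integrals may depend on the part, but not on the energy.
\<close>
lemma fuglede_modulus_eq_0:
  fixes \<mu> :: "'a::topological_space measure" and F :: "nat \<Rightarrow> 'a measure set"
  assumes p: "0 < p"
    and \<mu>: "sets borel \<subseteq> sets \<mu>"
    and \<Lambda>: "\<And>\<nu>. \<nu> \<in> \<Lambda> \<Longrightarrow> sets borel \<subseteq> sets \<nu>"
    and cover: "\<And>\<nu>. \<nu> \<in> \<Lambda> \<Longrightarrow> \<exists>n. \<nu> \<in> F n"
    and small: "\<And>n. \<exists>c>0. \<forall>\<epsilon>>0. \<exists>\<rho>\<in>borel_measurable borel.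
      (\<integral>\<^sup>+x. epowr (\<rho> x) p \<partial>\<mu>) \<le> ennreal \<epsilon> \<and> (\<forall>\<nu>\<in>F n. ennreal c \<le> (\<integral>\<^sup>+x. \<rho> x \<partial>\<nu>))"
  shows "fuglede_modulus p \<mu> \<Lambda> = 0"
proof -
  have bound: "fuglede_modulus p \<mu> \<Lambda> \<le> ennreal \<epsilon>" if "0 < \<epsilon>" for \<epsilon>
  proof -
    have "\<exists>\<rho>\<in>borel_measurable borel. (\<integral>\<^sup>+x. epowr (\<rho> x) p \<partial>\<mu>) \<le> ennreal (\<epsilon> * (1/2)^Suc n) \<and>
        (\<forall>\<nu>\<in>F n \<inter> \<Lambda>. 1 \<le> (\<integral>\<^sup>+x. \<rho> x \<partial>\<nu>))" for n
    proof -
      obtain c where c: "0 < c" and "\<forall>\<epsilon>>0. \<exists>\<rho>\<in>borel_measurable borel.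
          (\<integral>\<^sup>+x. epowr (\<rho> x) p \<partial>\<mu>) \<le> ennreal \<epsilon> \<and> (\<forall>\<nu>\<in>F n. ennreal c \<le> (\<integral>\<^sup>+x. \<rho> x \<partial>\<nu>))"
        using small by blast
      moreover have "0 < c powr p * (\<epsilon> * (1/2)^Suc n)"
        using c that by simp
      ultimately obtain \<rho> where \<rho>: "\<rho> \<in> borel_measurable borel"
        and e: "(\<integral>\<^sup>+x. epowr (\<rho> x) p \<partial>\<mu>) \<le> ennreal (c powr p * (\<epsilon> * (1/2)^Suc n))"
        and F: "\<And>\<nu>. \<nu> \<in> F n \<Longrightarrow> ennreal c \<le> (\<integral>\<^sup>+x. \<rho> x \<partial>\<nu>)"
        by blast
      have "(\<integral>\<^sup>+x. epowr (ennreal (1/c) * \<rho> x) p \<partial>\<mu>)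
          = ennreal ((1/c) powr p) * (\<integral>\<^sup>+x. epowr (\<rho> x) p \<partial>\<mu>)"
        using c borel_measurable_finer[OF borel_measurable_epowr[OF \<rho>] \<mu>]
        by (simp add: epowr_cmult nn_integral_cmult)
      also have "\<dots> \<le> ennreal ((1/c) powr p) * ennreal (c powr p * (\<epsilon> * (1/2)^Suc n))"
        by (rule mult_left_mono[OF e]) simp
      also have "\<dots> = ennreal (\<epsilon> * (1/2)^Suc n)"
        using c that by (simp add: powr_divide flip: ennreal_mult)
      finally have 1: "(\<integral>\<^sup>+x. epowr (ennreal (1/c) * \<rho> x) p \<partial>\<mu>) \<le> ennreal (\<epsilon> * (1/2)^Suc n)" .
      have 2: "1 \<le> (\<integral>\<^sup>+x. ennreal (1/c) * \<rho> x \<partial>\<nu>)" if "\<nu> \<in> F n \<inter> \<Lambda>" for \<nu>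
      proof -
        have "1 = ennreal (1/c) * ennreal c"
          using c by (simp flip: ennreal_mult)
        also have "\<dots> \<le> ennreal (1/c) * (\<integral>\<^sup>+x. \<rho> x \<partial>\<nu>)"
          using that by (intro mult_left_mono F) auto
        also have "\<dots> = (\<integral>\<^sup>+x. ennreal (1/c) * \<rho> x \<partial>\<nu>)"
          using that borel_measurable_finer[OF \<rho> \<Lambda>] by (simp add: nn_integral_cmult)
        finally show ?thesis .
      qed
      show ?thesis
        using 1 2 \<rho> by (intro bexI[of _ "\<lambda>x. ennreal (1/c) * \<rho> x"]) auto
    qed
    then obtain \<rho> where \<rho> [measurable]: "\<And>n. \<rho> n \<in> borel_measurable borel"
      and e: "\<And>n. (\<integral>\<^sup>+x. epowr (\<rho> n x) p \<partial>\<mu>) \<le> ennreal (\<epsilon> * (1/2)^Suc n)"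
      and F: "\<And>n \<nu>. \<nu> \<in> F n \<Longrightarrow> \<nu> \<in> \<Lambda> \<Longrightarrow> 1 \<le> (\<integral>\<^sup>+x. \<rho> n x \<partial>\<nu>)"
      by (metis IntI)
    define \<sigma> where "\<sigma> x = epowr (\<Sum>n. epowr (\<rho> n x) p) (1/p)" for x
    have [measurable]: "\<sigma> \<in> borel_measurable borel"
      unfolding \<sigma>_def by measurable
    have "\<rho> n x \<le> \<sigma> x" for n x
    proof -
      have "epowr (\<rho> n x) p \<le> (\<Sum>n. epowr (\<rho> n x) p)"
        by (rule le_suminf_ennreal)
      then have "epowr (epowr (\<rho> n x) p) (1/p) \<le> \<sigma> x"
        unfolding \<sigma>_def using p by (intro epowr_mono) auto
      then show ?thesis
        using p by (simp add: epowr_epowr)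
    qed
    then have "1 \<le> (\<integral>\<^sup>+x. \<sigma> x \<partial>\<nu>)" if "\<nu> \<in> \<Lambda>" for \<nu>
      using cover[OF that] F[OF _ that] by (meson nn_integral_mono order_trans)
    then have "fuglede_modulus p \<mu> \<Lambda> \<le> (\<integral>\<^sup>+x. epowr (\<sigma> x) p \<partial>\<mu>)"
      unfolding fuglede_modulus_def by (intro INF_lower) auto
    also have "\<dots> = (\<integral>\<^sup>+x. (\<Sum>n. epowr (\<rho> n x) p) \<partial>\<mu>)"
      using p by (simp add: \<sigma>_def epowr_epowr)
    also have "\<dots> = (\<Sum>n. \<integral>\<^sup>+x. epowr (\<rho> n x) p \<partial>\<mu>)"
      by (intro nn_integral_suminf borel_measurable_finer[OF _ \<mu>]) measurable
    also have "\<dots> \<le> (\<Sum>n. ennreal (\<epsilon> * (1/2)^Suc n))"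
      by (intro suminf_le e summableI)
    also have "\<dots> = ennreal \<epsilon>"
      using that sums_mult[OF power_half_series, of \<epsilon>] by (intro suminf_ennreal_eq) auto
    finally show ?thesis .
  qed
  show ?thesis
    using bound by (rule ennreal_eq_0I)
qed


section \<open>Hausdorff content\<close>

text \<open>
  The content is the premeasure without restriction of the diameters, that is, with
  \<open>\<delta> = top\<close>. Unlike the measure it is finite on bounded sets, and it has the same null sets.
\<close>

lemma hausdorff_premeasure_le:
  assumes "(\<Union>i. A i) = M" "\<And>i. ediam d (A i) \<le> \<delta>"
  shows "hausdorff_premeasure d s \<delta> M \<le> (\<Sum>i. epowr (ediam d (A i)) s)"
  unfolding hausdorff_premeasure_def using assms by (intro INF_lower) auto

lemma hausdorff_premeasure_cover:
  assumes "hausdorff_premeasure d s \<delta> M = 0" "0 < \<epsilon>"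
  obtains A :: "nat \<Rightarrow> 'a set" where "(\<Union>i. A i) = M" "\<And>i. ediam d (A i) \<le> \<delta>"
    "(\<Sum>i. epowr (ediam d (A i)) s) < \<epsilon>"
  using assms unfolding hausdorff_premeasure_def
  by (metis (mono_tags, lifting) INF_less_iff mem_Collect_eq)

lemma hausdorff_premeasure_UN_eq_0:
  fixes M :: "nat \<Rightarrow> 'a set"
  assumes "\<And>n. hausdorff_premeasure d s \<delta> (M n) = 0"
  shows "hausdorff_premeasure d s \<delta> (\<Union>n. M n) = 0"
proof -
  have "hausdorff_premeasure d s \<delta> (\<Union>n. M n) \<le> ennreal \<epsilon>" if "0 < \<epsilon>" for \<epsilon>
  proof -
    have "\<exists>A :: nat \<Rightarrow> 'a set. (\<Union>i. A i) = M n \<and> (\<forall>i. ediam d (A i) \<le> \<delta>) \<and>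
        (\<Sum>i. epowr (ediam d (A i)) s) < ennreal (\<epsilon> * (1/2)^Suc n)" for n
    proof -
      have "0 < ennreal (\<epsilon> * (1/2)^Suc n)" using that by simp
      from hausdorff_premeasure_cover[OF assms[of n] this] show ?thesis by metis
    qed
    then obtain A :: "nat \<Rightarrow> nat \<Rightarrow> 'a set" where A: "\<And>n. (\<Union>i. A n i) = M n"
      and \<delta>: "\<And>n i. ediam d (A n i) \<le> \<delta>"
      and less: "\<And>n. (\<Sum>i. epowr (ediam d (A n i)) s) < ennreal (\<epsilon> * (1/2)^Suc n)"
      by metis
    let ?B = "\<lambda>j. case_prod A (prod_decode j)"
    have "(\<Union>j. ?B j) = \<Union>(case_prod A ` range prod_decode)"
      by (simp only: image_image)
    also have "\<dots> = (\<Union>n. M n)"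
      unfolding A[symmetric] by (auto simp: surj_prod_decode)
    finally have "hausdorff_premeasure d s \<delta> (\<Union>n. M n) \<le> (\<Sum>j. epowr (ediam d (?B j)) s)"
      using \<delta> by (intro hausdorff_premeasure_le) (auto split: prod.splits)
    also have "\<dots> = (\<Sum>n. \<Sum>i. epowr (ediam d (A n i)) s)"
      by (subst suminf_ennreal_2dimen[symmetric, where f = "\<lambda>m. epowr (ediam d (case_prod A m)) s"]) auto
    also have "\<dots> \<le> (\<Sum>n. ennreal (\<epsilon> * (1/2)^Suc n))"
      using less by (intro suminf_le summableI) (auto intro: less_imp_le)
    also have "\<dots> = ennreal \<epsilon>"
      using that sums_mult[OF power_half_series, of \<epsilon>] by (intro suminf_ennreal_eq) auto
    finally show ?thesis .
  qed
  then show ?thesis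
    by (rule ennreal_eq_0I)
qed

text \<open>
  A cover whose total cost is below \<open>\<delta>\<close> to the power \<open>s\<close> consists of sets of diameter at most \<open>\<delta>\<close>.
\<close>
lemma hausdorff_measure_eq_0:
  assumes s: "0 < s" and "hausdorff_premeasure d s top M = 0"
  shows "hausdorff_measure d s M = 0"
proof -
  have "hausdorff_premeasure d s \<delta> M = 0" if \<delta>: "0 < \<delta>" for \<delta>
  proof -
    have "hausdorff_premeasure d s \<delta> M \<le> ennreal \<epsilon>" if \<epsilon>: "0 < \<epsilon>" for \<epsilon>
    proof -
      have "0 < min (ennreal \<epsilon>) (epowr \<delta> s)"
        using \<epsilon> \<delta> by (simp add: epowr_pos)
      from hausdorff_premeasure_cover[OF assms(2) this]
      obtain A where A: "(\<Union>i. A i) = M"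
        and sum: "(\<Sum>i. epowr (ediam d (A i)) s) < min (ennreal \<epsilon>) (epowr \<delta> s)"
        by blast
      have "ediam d (A i) \<le> \<delta>" for i
      proof (rule ccontr)
        assume "\<not> ?thesis"
        then have "epowr \<delta> s \<le> epowr (ediam d (A i)) s"
          using s by (intro epowr_mono) auto
        moreover have "epowr (ediam d (A i)) s < epowr \<delta> s"
          using ennreal_suminf_lessD[OF sum, of i] by simp
        ultimately show False by simp
      qed
      then have "hausdorff_premeasure d s \<delta> M \<le> (\<Sum>i. epowr (ediam d (A i)) s)"
        by (rule hausdorff_premeasure_le[OF A])
      also have "\<dots> \<le> ennreal \<epsilon>"
        using sum by auto
      finally show ?thesis .
    qed
    then show ?thesis
      by (rule ennreal_eq_0I)
  qed
  then have "hausdorff_measure d s M \<le> 0"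
    unfolding hausdorff_measure_def by (intro SUP_least) auto
  then show ?thesis by simp
qed

lemma hausdorff_premeasure_le_hausdorff_measure:
  "0 < \<delta> \<Longrightarrow> hausdorff_premeasure d s \<delta> M \<le> hausdorff_measure d s M"
  unfolding hausdorff_measure_def by (intro SUP_upper) auto


section \<open>Maximal separated sets\<close>

lemma maximal_separated_subset:
  fixes I :: "'i set" and P :: "'i \<Rightarrow> 'i \<Rightarrow> bool"
  assumes sym: "symp P"
  obtains S where "S \<subseteq> I" "pairwise P S" "\<And>i. i \<in> I \<Longrightarrow> i \<notin> S \<Longrightarrow> \<exists>j\<in>S. \<not> P i j"
proof -
  let ?A = "{S. S \<subseteq> I \<and> pairwise P S}"
  have "\<exists>M\<in>?A. \<forall>X\<in>?A. M \<subseteq> X \<longrightarrow> X = M"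
  proof (rule subset_Zorn')
    fix C assume "subset.chain ?A C"
    then have C: "\<And>S. S \<in> C \<Longrightarrow> S \<subseteq> I \<and> pairwise P S"
      and ch: "\<And>S T. S \<in> C \<Longrightarrow> T \<in> C \<Longrightarrow> S \<subseteq> T \<or> T \<subseteq> S"
      by (auto simp: subset_chain_def)
    have "pairwise P (\<Union>C)"
    proof (rule pairwiseI)
      fix i j assume "i \<in> \<Union>C" "j \<in> \<Union>C" and ij: "i \<noteq> j"
      then obtain S T where "S \<in> C" "T \<in> C" "i \<in> S" "j \<in> T" by blast
      then obtain U where "U \<in> C" "i \<in> U" "j \<in> U"
        using ch[of S T] by blast
      then show "P i j"
        using C ij by (auto dest: pairwiseD)
    qed
    then show "\<Union>C \<in> ?A" using C by auto
  qed
  then obtain S where "S \<in> ?A" and "\<forall>X\<in>?A. S \<subseteq> X \<longrightarrow> X = S" ..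
  then have S: "S \<subseteq> I" "pairwise P S"
    and max: "\<And>X. X \<subseteq> I \<Longrightarrow> pairwise P X \<Longrightarrow> S \<subseteq> X \<Longrightarrow> X = S"
    by simp_all
  show thesis
  proof (rule that[OF S])
    fix i assume i: "i \<in> I" "i \<notin> S"
    show "\<exists>j\<in>S. \<not> P i j"
    proof (rule ccontr)
      assume "\<not> ?thesis"
      then have "pairwise P (insert i S)"
        using S(2) sym by (auto simp: pairwise_insert dest: sympD)
      with max[of "insert i S"] i S(1) show False by blast
    qed
  qed
qed


section \<open>Metrics quasisymmetrically equivalent to the given one\<close>

text \<open>
  A second metric \<open>e\<close> on the same points, continuous for \<open>dist\<close> and quasisymmetric to it, the distortion
  function being replaced by what it is used for: \<open>e x y / e x z\<close> is bounded as long as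
  \<open>dist x y / dist x z\<close> is. This form also covers \<open>x = z\<close>.
\<close>
locale quasisymmetric_metric = Metric_space "UNIV :: 'a set" e
  for e :: "'a::metric_space \<Rightarrow> 'a \<Rightarrow> real" +
  assumes continuous: "0 < \<epsilon> \<Longrightarrow> \<exists>\<delta>>0. \<forall>y. dist x y < \<delta> \<longrightarrow> e x y < \<epsilon>"
    and control: "\<exists>K. \<forall>x y z. dist x y \<le> c * dist x z \<longrightarrow> e x y \<le> K * e x z"
begin

lemma tri: "e x z \<le> e x y + e y z"
  using triangle[of x y z] by simp

lemma e_zero_iff: "e x y = 0 \<longleftrightarrow> x = y"
  using zero[of x y] by simp

lemma control_ge_1: "\<exists>K\<ge>1. \<forall>x y z. dist x y \<le> c * dist x z \<longrightarrow> e x y \<le> K * e x z"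
proof -
  obtain K where K: "\<And>x y z. dist x y \<le> c * dist x z \<Longrightarrow> e x y \<le> K * e x z"
    using control by blast
  have "e x y \<le> max K 1 * e x z" if "dist x y \<le> c * dist x z" for x y z
    using K[OF that] mult_right_mono[of K "max K 1" "e x z"] by simp
  then show ?thesis by (intro exI[of _ "max K 1"]) auto
qed

text \<open>
  On bounded sets, points that are close for \<open>e\<close> are uniformly close: the distance of two fixed
  points serves as a yardstick for \<open>e\<close> in a bounded region.
\<close>
lemma uniformly_far:
  assumes \<delta>: "0 < \<delta>"
  shows "\<exists>\<tau>>0. \<forall>x\<in>ball p r. \<forall>y. \<delta> \<le> dist x y \<longrightarrow> \<tau> \<le> e x y"
proof (cases "\<exists>a b :: 'a. a \<noteq> b")
  case True
  then obtain a b :: 'a where ab: "a \<noteq> b" by blast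
  define c where "c = (r + dist p a + dist p b) / \<delta>"
  obtain K where K: "K \<ge> 1" "\<And>x y z. dist x y \<le> c * dist x z \<Longrightarrow> e x y \<le> K * e x z"
    using control_ge_1 by blast
  have "e a b / (2 * K) \<le> e x y" if x: "x \<in> ball p r" and y: "\<delta> \<le> dist x y" for x y
  proof -
    have r: "0 < r" using x by (metis ball_empty empty_iff not_less)
    have "r + dist p a + dist p b = c * \<delta>" using \<delta> by (simp add: c_def)
    also have "\<dots> \<le> c * dist x y"
      using y r \<delta> by (intro mult_left_mono) (auto simp: c_def)
    finally have *: "r + dist p a + dist p b \<le> c * dist x y" .
    have "dist x a \<le> dist p x + dist p a" "dist x b \<le> dist p x + dist p b"
      by (metis dist_commute dist_triangle)+
    moreover have "dist p x < r" using x by simp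
    ultimately have "dist x a \<le> c * dist x y" "dist x b \<le> c * dist x y"
      using * zero_le_dist[of p a] zero_le_dist[of p b] by linarith+
    then have "e x a \<le> K * e x y" "e x b \<le> K * e x y" by (auto intro: K(2))
    then have "e a b \<le> 2 * K * e x y"
      using tri[of a b x] commute[of a x] by simp
    then show ?thesis
      using K(1) by (simp add: divide_le_eq mult.commute)
  qed
  moreover have "0 < e a b / (2 * K)"
    using K(1) ab e_zero_iff[of a b] nonneg[of a b] by auto
  ultimately show ?thesis by blast
next
  case False
  then have "\<not> \<delta> \<le> dist x y" for x y :: 'a using \<delta> by (metis dist_self not_le)
  then show ?thesis by (intro exI[of _ 1]) auto
qed

lemma ediam_bound:
  assumes "ediam e A \<le> ennreal r" "0 \<le> r" "u \<in> A" "v \<in> A"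
  shows "e u v \<le> r"
proof -
  have "ennreal (e u v) \<le> ediam e A"
    unfolding ediam_def using assms(3,4) by (intro SUP_upper2[of u] SUP_upper2[of v]) auto
  with assms(1,2) show ?thesis
    by (metis ennreal_le_iff order_trans)
qed

text \<open>
  Every bounded set \<open>A\<close> has a dyadic scale, comparable with its diameter, such that the balls
  of that scale centred in \<open>A\<close> have \<open>e\<close>-diameter at most a multiple of that of \<open>A\<close>. A single point
  has no scale of its own; by continuity every sufficiently small one will do.
\<close>
lemma dyadic_scale:
  "\<exists>C\<ge>1. \<forall>k0 A D. A \<noteq> {} \<longrightarrow> (\<forall>u\<in>A. \<forall>v\<in>A. dist u v \<le> (1/2)^k0) \<longrightarrow> 0 < D \<longrightarrow>
     (\<forall>u\<in>A. \<forall>v\<in>A. e u v \<le> D) \<longrightarrow>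
     (\<exists>k\<ge>k0. (\<forall>u\<in>A. \<forall>v\<in>A. dist u v \<le> (1/2)^k) \<and>
        (\<forall>y\<in>A. ediam e (ball y (3 * (1/2)^k)) \<le> ennreal (C * D)))"
proof -
  obtain K where K: "K \<ge> 1" "\<And>x y z. dist x y \<le> 8 * dist x z \<Longrightarrow> e x y \<le> K * e x z"
    using control_ge_1 by blast
  have diam: "ediam e B \<le> ennreal (2 * K * D)" if B: "\<And>w. w \<in> B \<Longrightarrow> e u w \<le> K * D" for B u D
    unfolding ediam_def
  proof (intro SUP_least ennreal_leI)
    fix w w' assume w: "w \<in> B" "w' \<in> B"
    have "e w w' \<le> e u w + e u w'" using tri[of w w' u] commute[of w u] by simp
    then show "e w w' \<le> 2 * K * D" using B[OF w(1)] B[OF w(2)] by simp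
  qed
  have "\<exists>k\<ge>k0. (\<forall>u\<in>A. \<forall>v\<in>A. dist u v \<le> (1/2)^k) \<and>
        (\<forall>y\<in>A. ediam e (ball y (3 * (1/2)^k)) \<le> ennreal (2 * K * D))"
    if ne: "A \<noteq> {}" and A: "\<And>u v. u \<in> A \<Longrightarrow> v \<in> A \<Longrightarrow> dist u v \<le> (1/2)^k0"
      and D: "0 < D" "\<And>u v. u \<in> A \<Longrightarrow> v \<in> A \<Longrightarrow> e u v \<le> D" for k0 A D
  proof (cases "\<exists>u\<in>A. \<exists>v\<in>A. u \<noteq> v")
    case True
    then obtain a b where ab: "a \<in> A" "b \<in> A" "a \<noteq> b" by blast
    define P where "P l \<longleftrightarrow> (\<exists>u\<in>A. \<exists>v\<in>A. (1/2::real)^l < dist u v)" for l :: nat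
    obtain m where "(1/2)^m < dist a b"
      using ab real_arch_pow_inv[of "dist a b" "1/2"] by auto
    then have "P m" using ab unfolding P_def by blast
    \<comment> \<open>The first scale at which \<open>A\<close> is too large; the one before it is the scale of \<open>A\<close>.\<close>
    define l where "l = (LEAST l. P l)"
    have l: "P l" unfolding l_def using \<open>P m\<close> by (rule LeastI)
    have "k0 < l"
    proof (rule ccontr)
      assume "\<not> k0 < l"
      then have "(1/2::real)^k0 \<le> (1/2)^l" by (intro power_decreasing) auto
      then show False using l A unfolding P_def by (meson leD order_trans)
    qed
    then obtain k where k: "l = Suc k" "k0 \<le> k"
      by (metis less_Suc_eq_le less_imp_Suc_add le_add1)
    have "\<not> P k" using not_less_Least[of k P] k(1) l_def by simp
    then have small: "dist u v \<le> (1/2)^k" if "u \<in> A" "v \<in> A" for u v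
      using that unfolding P_def by force
    obtain u v where uv: "u \<in> A" "v \<in> A" "(1/2)^k < 2 * dist u v"
      using l unfolding P_def k(1) by auto
    have "ediam e (ball y (3 * (1/2)^k)) \<le> ennreal (2 * K * D)" if y: "y \<in> A" for y
    proof (rule diam[of _ u])
      fix w assume w: "w \<in> ball y (3 * (1/2)^k)"
      have "dist u w \<le> dist u y + dist y w" by (rule dist_triangle)
      also have "\<dots> \<le> 4 * (1/2)^k" using w small[OF uv(1) y] by simp
      also have "\<dots> \<le> 8 * dist u v" using uv(3) by simp
      finally have "e u w \<le> K * e u v" by (rule K(2))
      also have "\<dots> \<le> K * D" using K(1) D(2)[OF uv(1,2)] by (intro mult_left_mono) auto
      finally show "e u w \<le> K * D" .
    qed
    then show ?thesis using k(2) small by blast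
  next
    case False
    then obtain x where x: "A = {x}" using ne by blast
    obtain \<delta> where \<delta>: "0 < \<delta>" "\<And>y. dist x y < \<delta> \<Longrightarrow> e x y < D"
      using continuous[OF D(1)] by blast
    obtain m where m: "(1/2)^m < \<delta> / 3"
      using \<delta>(1) real_arch_pow_inv[of "\<delta> / 3" "1/2"] by auto
    define k where "k = max k0 m"
    have "(1/2::real)^k \<le> (1/2)^m" by (intro power_decreasing) (auto simp: k_def)
    with m have k: "3 * (1/2)^k < \<delta>" by linarith
    have "ediam e (ball x (3 * (1/2)^k)) \<le> ennreal (2 * K * D)"
    proof (rule diam[of _ x])
      fix w assume "w \<in> ball x (3 * (1/2)^k)"
      then have "e x w < D" using k by (intro \<delta>(2)) auto
      also have "D \<le> K * D" using K(1) D(1) by simp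
      finally show "e x w \<le> K * D" by simp
    qed
    then show ?thesis
      unfolding x by (intro exI[of _ k]) (auto simp: k_def)
  qed
  then show ?thesis
    using K(1) by (intro exI[of _ "2 * K"]) auto
qed

text \<open>
  A space that is null for the \<open>t\<close>-dimensional measure of \<open>e\<close> has arbitrarily cheap covers
  consisting, over a bounded region, of arbitrarily small sets with their scales. The number
  \<open>D i\<close> is slightly larger than the \<open>e\<close>-diameter of \<open>A i\<close>, so as to be positive even for single points.
\<close>
lemma scaled_cover:
  assumes t: "0 < t" and null: "hausdorff_measure e t UNIV = 0"
  shows "\<exists>C\<ge>1. \<forall>p r k0 \<epsilon>. 0 < \<epsilon> \<longrightarrow> (\<exists>(A :: nat \<Rightarrow> 'a set) D k. (\<Union>i. A i) = UNIV \<and>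
     (\<forall>i. 0 < D i) \<and> (\<Sum>i. ennreal (D i powr t)) \<le> ennreal \<epsilon> \<and>
     (\<forall>i. A i \<inter> ball p r \<noteq> {} \<longrightarrow> k0 \<le> k i \<and> (\<forall>u\<in>A i. \<forall>v\<in>A i. dist u v \<le> (1/2)^k i) \<and>
        (\<forall>y\<in>A i. ediam e (ball y (3 * (1/2)^k i)) \<le> ennreal (C * D i))))"
proof -
  obtain C where C: "C \<ge> 1" and scale: "\<And>k0 A D. A \<noteq> {} \<Longrightarrow>
     (\<forall>u\<in>A. \<forall>v\<in>A. dist u v \<le> (1/2)^k0) \<Longrightarrow> 0 < D \<Longrightarrow> (\<forall>u\<in>A. \<forall>v\<in>A. e u v \<le> D) \<Longrightarrow>
     (\<exists>k\<ge>k0. (\<forall>u\<in>A. \<forall>v\<in>A. dist u v \<le> (1/2)^k) \<and>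
        (\<forall>y\<in>A. ediam e (ball y (3 * (1/2)^k)) \<le> ennreal (C * D)))"
    using dyadic_scale by metis
  have "\<exists>(A :: nat \<Rightarrow> 'a set) D k. (\<Union>i. A i) = UNIV \<and>
     (\<forall>i. 0 < D i) \<and> (\<Sum>i. ennreal (D i powr t)) \<le> ennreal \<epsilon> \<and>
     (\<forall>i. A i \<inter> ball p r \<noteq> {} \<longrightarrow> k0 \<le> k i \<and> (\<forall>u\<in>A i. \<forall>v\<in>A i. dist u v \<le> (1/2)^k i) \<and>
        (\<forall>y\<in>A i. ediam e (ball y (3 * (1/2)^k i)) \<le> ennreal (C * D i)))"
    if \<epsilon>: "0 < \<epsilon>" for p :: 'a and r k0 \<epsilon>
  proof -
    obtain \<tau> where \<tau>: "0 < \<tau>"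
      and far: "\<And>x y. x \<in> ball p r \<Longrightarrow> (1/2)^Suc k0 \<le> dist x y \<Longrightarrow> \<tau> \<le> e x y"
      using uniformly_far[of "(1/2)^Suc k0" p r] by auto
    have "hausdorff_premeasure e t (ennreal (\<tau>/2)) UNIV = 0"
      using hausdorff_premeasure_le_hausdorff_measure[of "ennreal (\<tau>/2)" e t UNIV] null \<tau> by simp
    moreover have "0 < ennreal (\<epsilon>/2)" using \<epsilon> by simp
    ultimately obtain A :: "nat \<Rightarrow> 'a set" where A: "(\<Union>i. A i) = UNIV"
      and Adiam: "\<And>i. ediam e (A i) \<le> ennreal (\<tau>/2)"
      and Asum: "(\<Sum>i. epowr (ediam e (A i)) t) < ennreal (\<epsilon>/2)"
      by (rule hausdorff_premeasure_cover) (rule that)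
    define \<Delta> where "\<Delta> i = enn2real (ediam e (A i))" for i
    have \<Delta>: "ediam e (A i) = ennreal (\<Delta> i)" for i
      unfolding \<Delta>_def using Adiam[of i] by (metis ennreal_enn2real ennreal_less_top le_less_trans)
    have \<Delta>0: "0 \<le> \<Delta> i" for i by (simp add: \<Delta>_def)
    define D where "D i = (\<Delta> i powr t + \<epsilon>/2 * (1/2)^Suc i) powr (1/t)" for i
    have D0: "0 < D i" for i
    proof -
      have "0 < \<Delta> i powr t + \<epsilon>/2 * (1/2)^Suc i" using \<epsilon> by (intro add_nonneg_pos) auto
      then show ?thesis by (simp add: D_def)
    qed
    have D_t: "D i powr t = \<Delta> i powr t + \<epsilon>/2 * (1/2)^Suc i" for i
      using t \<epsilon> by (simp add: D_def powr_powr)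
    have \<Delta>D: "\<Delta> i \<le> D i" for i
    proof -
      have "\<Delta> i = (\<Delta> i powr t) powr (1/t)" using t \<Delta>0 by (simp add: powr_powr)
      also have "\<dots> \<le> D i" unfolding D_def using t \<epsilon> by (intro powr_mono2) auto
      finally show ?thesis .
    qed
    have "(\<Sum>i. ennreal (D i powr t)) = (\<Sum>i. epowr (ediam e (A i)) t + ennreal (\<epsilon>/2 * (1/2)^Suc i))"
      using \<epsilon> \<Delta>0 by (simp add: D_t \<Delta> epowr_ennreal)
    also have "\<dots> = (\<Sum>i. epowr (ediam e (A i)) t) + (\<Sum>i. ennreal (\<epsilon>/2 * (1/2)^Suc i))"
      by (rule suminf_add[symmetric]) auto
    also have "\<dots> \<le> ennreal (\<epsilon>/2) + (\<Sum>i. ennreal (\<epsilon>/2 * (1/2)^Suc i))"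
      using Asum by (intro add_right_mono) auto
    also have "(\<Sum>i. ennreal (\<epsilon>/2 * (1/2)^Suc i)) = ennreal (\<epsilon>/2)"
      using \<epsilon> sums_mult[OF power_half_series, of "\<epsilon>/2"] by (intro suminf_ennreal_eq) auto
    finally have sum: "(\<Sum>i. ennreal (D i powr t)) \<le> ennreal \<epsilon>"
      using \<epsilon> by (simp flip: ennreal_plus)
    have "\<exists>k. A i \<inter> ball p r \<noteq> {} \<longrightarrow> k0 \<le> k \<and> (\<forall>u\<in>A i. \<forall>v\<in>A i. dist u v \<le> (1/2)^k) \<and>
        (\<forall>y\<in>A i. ediam e (ball y (3 * (1/2)^k)) \<le> ennreal (C * D i))" for i
    proof (cases "A i \<inter> ball p r = {}")
      case False
      then obtain x where x: "x \<in> A i" "x \<in> ball p r" by blast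
      have near: "dist x u < (1/2)^Suc k0" if "u \<in> A i" for u
      proof (rule ccontr)
        assume "\<not> ?thesis"
        then have "\<tau> \<le> e x u" using far x(2) by simp
        then show False using ediam_bound[OF Adiam _ x(1) that] \<tau> by simp
      qed
      have 1: "\<forall>u\<in>A i. \<forall>v\<in>A i. dist u v \<le> (1/2)^k0"
      proof (intro ballI)
        fix u v assume uv: "u \<in> A i" "v \<in> A i"
        have "dist u v \<le> dist x u + dist x v" by (metis dist_commute dist_triangle)
        then show "dist u v \<le> (1/2)^k0" using near[OF uv(1)] near[OF uv(2)] by simp
      qed
      have 2: "\<forall>u\<in>A i. \<forall>v\<in>A i. e u v \<le> D i"
        using ediam_bound[of "A i" "\<Delta> i"] \<Delta> \<Delta>0 \<Delta>D by (metis order_refl order_trans)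
      have "A i \<noteq> {}" using x(1) by blast
      from scale[OF this 1 D0 2] show ?thesis by blast
    qed simp
    then obtain k where "\<And>i. A i \<inter> ball p r \<noteq> {} \<longrightarrow> k0 \<le> k i \<and>
        (\<forall>u\<in>A i. \<forall>v\<in>A i. dist u v \<le> (1/2)^k i) \<and>
        (\<forall>y\<in>A i. ediam e (ball y (3 * (1/2)^k i)) \<le> ennreal (C * D i))"
      by metis
    with A D0 sum show ?thesis by blast
  qed
  with C show ?thesis by (intro exI[of _ C] conjI allI impI)
qed

end


section \<open>The test functions\<close>

text \<open>
  On a set of finite measure a small integral forces small integrals of powers below \<open>1\<close>.
\<close>
lemma small_integral_epowr:
  assumes \<theta>: "0 < \<theta>" "\<theta> < 1" and B: "B \<in> sets \<mu>" "emeasure \<mu> B < top" and \<epsilon>: "0 < \<epsilon>"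
  shows "\<exists>\<kappa>>0. \<forall>\<psi>\<in>borel_measurable \<mu>. (\<forall>x. x \<notin> B \<longrightarrow> \<psi> x = 0) \<longrightarrow>
    (\<integral>\<^sup>+x. \<psi> x \<partial>\<mu>) \<le> ennreal \<kappa> \<longrightarrow> (\<integral>\<^sup>+x. epowr (\<psi> x) \<theta> \<partial>\<mu>) \<le> ennreal \<epsilon>"
proof -
  define V where "V = enn2real (emeasure \<mu> B)"
  have V: "emeasure \<mu> B = ennreal V" "0 \<le> V"
    using B(2) by (simp_all add: V_def)
  \<comment> \<open>Below the height \<open>h\<close> the power is bounded by a constant, above it by a multiple of \<open>\<psi>\<close>.\<close>
  define h where "h = (\<epsilon> / (2 * (V + 1))) powr (1/\<theta>)"
  have h: "0 < h" using \<epsilon> V(2) by (simp add: h_def)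
  have h_\<theta>: "h powr \<theta> = \<epsilon> / (2 * (V + 1))"
    using \<epsilon> V(2) \<theta> by (simp add: h_def powr_powr)
  have hV: "h powr \<theta> * V \<le> \<epsilon> / 2"
    using \<epsilon> V(2) by (simp add: h_\<theta> field_simps)
  have pointwise: "epowr y \<theta> \<le> ennreal (h powr \<theta>) + ennreal (h powr (\<theta> - 1)) * y" for y
  proof (cases y rule: ennreal_cases)
    case y: (real b)
    have "b powr \<theta> \<le> h powr \<theta> + h powr (\<theta> - 1) * b"
    proof (cases "b \<le> h")
      case True
      then have "b powr \<theta> \<le> h powr \<theta>" using y(1) \<theta> by (intro powr_mono2) auto
      moreover have "0 \<le> h powr (\<theta> - 1) * b" using y(1) by simp
      ultimately show ?thesis by linarith
    next
      case False
      then have b: "0 < b" using h by linarith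
      have "b powr \<theta> = b powr (\<theta> - 1) * b" using b by (simp add: powr_diff)
      also have "\<dots> \<le> h powr (\<theta> - 1) * b"
        using False h b \<theta> by (intro mult_right_mono powr_mono2') auto
      finally show ?thesis using powr_ge_zero[of h \<theta>] by linarith
    qed
    then show ?thesis
      using y by (simp add: epowr_ennreal flip: ennreal_mult ennreal_plus)
  next
    case top
    then show ?thesis using h by (simp add: ennreal_mult_top)
  qed
  define \<kappa> where "\<kappa> = \<epsilon> / 2 / h powr (\<theta> - 1)"
  have \<kappa>: "0 < \<kappa>" using \<epsilon> h by (simp add: \<kappa>_def)
  have "(\<integral>\<^sup>+x. epowr (\<psi> x) \<theta> \<partial>\<mu>) \<le> ennreal \<epsilon>"
    if [measurable]: "\<psi> \<in> borel_measurable \<mu>" and off: "\<And>x. x \<notin> B \<Longrightarrow> \<psi> x = 0"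
      and small: "(\<integral>\<^sup>+x. \<psi> x \<partial>\<mu>) \<le> ennreal \<kappa>" for \<psi>
  proof -
    have [measurable]: "B \<in> sets \<mu>" by (rule B)
    have "(\<integral>\<^sup>+x. epowr (\<psi> x) \<theta> \<partial>\<mu>)
        \<le> (\<integral>\<^sup>+x. ennreal (h powr \<theta>) * indicator B x + ennreal (h powr (\<theta> - 1)) * \<psi> x \<partial>\<mu>)"
    proof (rule nn_integral_mono)
      fix x
      show "epowr (\<psi> x) \<theta> \<le> ennreal (h powr \<theta>) * indicator B x + ennreal (h powr (\<theta> - 1)) * \<psi> x"
        using pointwise[of "\<psi> x"] off[of x] by (cases "x \<in> B") auto
    qed
    also have "\<dots> = ennreal (h powr \<theta>) * emeasure \<mu> B + ennreal (h powr (\<theta> - 1)) * (\<integral>\<^sup>+x. \<psi> x \<partial>\<mu>)"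
      by (simp add: nn_integral_add nn_integral_cmult)
    also have "\<dots> \<le> ennreal (\<epsilon> / 2) + ennreal (h powr (\<theta> - 1)) * ennreal \<kappa>"
      unfolding V(1) using hV V(2) by (intro add_mono mult_left_mono small) (auto intro: ennreal_leI simp flip: ennreal_mult)
    also have "\<dots> = ennreal \<epsilon>"
      using \<epsilon> h \<kappa> by (simp add: \<kappa>_def flip: ennreal_mult ennreal_plus)
    finally show ?thesis .
  qed
  then show ?thesis using \<kappa> by (intro exI[of _ \<kappa>]) auto
qed

lemma suminf_power_inj_le:
  fixes \<beta> :: real and k :: "nat \<Rightarrow> nat"
  assumes \<beta>: "0 \<le> \<beta>" "\<beta> < 1" and inj: "inj_on k T"
  shows "(\<Sum>i. ennreal (\<beta> ^ k i) * indicator T i) \<le> ennreal (1 / (1 - \<beta>))"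
proof (rule suminf_le_const)
  fix n
  have "(\<Sum>i<n. ennreal (\<beta> ^ k i) * indicator T i) = (\<Sum>i\<in>{..<n} \<inter> T. ennreal (\<beta> ^ k i))"
    by (auto simp: sum.inter_restrict indicator_def intro!: sum.cong)
  also have "\<dots> = ennreal (\<Sum>i\<in>{..<n} \<inter> T. \<beta> ^ k i)"
    using \<beta> by (intro sum_ennreal) auto
  also have "(\<Sum>i\<in>{..<n} \<inter> T. \<beta> ^ k i) = (\<Sum>j\<in>k ` ({..<n} \<inter> T). \<beta> ^ j)"
    using inj by (subst sum.reindex) (auto intro: inj_on_subset)
  also have "\<dots> \<le> (\<Sum>j. \<beta> ^ j)"
    using \<beta> by (intro sum_le_suminf summable_geometric) auto
  also have "\<dots> = 1 / (1 - \<beta>)"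
    using \<beta> by (intro suminf_geometric) auto
  finally show "(\<Sum>i<n. ennreal (\<beta> ^ k i) * indicator T i) \<le> ennreal (1 / (1 - \<beta>))"
    by (simp add: ennreal_leI)
qed (rule summableI)

lemma half_power_powr: "((1/2)^k) powr a = ((1/2::real) powr a) ^ k"
  by (simp add: powr_powr mult.commute flip: powr_realpow)

context quasisymmetric_metric
begin

text \<open>
  The lower bound for one measure. A choice of the indices whose balls \<open>ball (y i) (R i)\<close> are
  disjoint within each scale \<open>R i\<close> is weighted by \<open>D i powr \<alpha> * R i powr - s\<close>. At a point of such a
  ball this weight is at most \<open>R i powr \<delta> * \<rho>\<close>, and a point lies in one chosen ball of each scale at most,
  so the weighted sum is at most \<open>\<rho>\<close> times a geometric series of ratio \<open>(1/2) powr \<delta>\<close>. By the lower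
  mass bound each term has integral at least \<open>C1 * D i powr \<alpha>\<close>; by maximality of the choice the balls
  three times as large cover \<open>M\<close>, so the sum of these integrals dominates the content of \<open>M\<close>.
\<close>
lemma integral_ge_content:
  fixes \<nu> :: "'a measure" and A :: "nat \<Rightarrow> 'a set" and x :: "nat \<Rightarrow> 'a" and k :: "nat \<Rightarrow> nat"
  defines "R \<equiv> \<lambda>i. (1/2::real) ^ k i"
  assumes \<nu>: "sets borel \<subseteq> sets \<nu>"
    and \<rho>: "\<rho> \<in> borel_measurable borel"
    and \<delta>: "0 < \<delta>" and \<alpha>: "0 < \<alpha>" and C: "1 \<le> C" and C1: "0 < C1"
    and D: "\<And>i. 0 < D i"
    and M: "M \<subseteq> (\<Union>i. A i)"
    and x: "\<And>i. A i \<inter> M \<noteq> {} \<Longrightarrow> x i \<in> A i"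
    and diam: "\<And>i u v. A i \<inter> M \<noteq> {} \<Longrightarrow> u \<in> A i \<Longrightarrow> v \<in> A i \<Longrightarrow> dist u v \<le> R i"
    and image_diam: "\<And>i y. A i \<inter> M \<noteq> {} \<Longrightarrow> y \<in> A i \<Longrightarrow> ediam e (ball y (3 * R i)) \<le> ennreal (C * D i)"
    and mass: "\<And>i y. A i \<inter> M \<noteq> {} \<Longrightarrow> y \<in> M \<Longrightarrow> ennreal (C1 * R i powr s) \<le> emeasure \<nu> (ball y (R i))"
    and \<rho>_ge: "\<And>i z. A i \<inter> M \<noteq> {} \<Longrightarrow> z \<in> ball (x i) (2 * R i) \<Longrightarrow>
        ennreal (D i powr \<alpha> * R i powr (- s - \<delta>)) \<le> \<rho> z"
  shows "ennreal (C1 * C powr (- \<alpha>) * (1 - (1/2) powr \<delta>)) * hausdorff_premeasure e \<alpha> top M \<le> (\<integral>\<^sup>+z. \<rho> z \<partial>\<nu>)"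
proof -
  have R: "0 < R i" for i by (simp add: R_def)
  define I where "I = {i. A i \<inter> M \<noteq> {}}"
  have "\<exists>y. i \<in> I \<longrightarrow> y \<in> A i \<inter> M" for i by (auto simp: I_def)
  then obtain y where y: "\<And>i. i \<in> I \<Longrightarrow> y i \<in> A i" "\<And>i. i \<in> I \<Longrightarrow> y i \<in> M"
    by (metis IntD1 IntD2)
  \<comment> \<open>Only balls of the same scale are separated.\<close>
  define P where "P i j \<longleftrightarrow> k i \<noteq> k j \<or> 2 * R i \<le> dist (y i) (y j)" for i j
  have "symp P" by (auto simp: symp_def P_def R_def dist_commute)
  then obtain S where S: "S \<subseteq> I" "pairwise P S" and max: "\<And>i. i \<in> I \<Longrightarrow> i \<notin> S \<Longrightarrow> \<exists>j\<in>S. \<not> P i j"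
    by (rule maximal_separated_subset) (rule that)
  define U where "U i = ball (y i) (R i)" for i
  define w where "w i = D i powr \<alpha> * R i powr (- s) * indicator S i" for i
  have w0: "0 \<le> w i" for i by (simp add: w_def)
  have U[measurable]: "U i \<in> sets \<nu>" for i
    using \<nu> by (auto simp: U_def)
  define \<beta> where "\<beta> = (1/2::real) powr \<delta>"
  have \<beta>: "0 < \<beta>" "\<beta> < 1"
    using \<delta> powr_less_mono2[of \<delta> "1/2" 1] by (auto simp: \<beta>_def)
  have R_\<delta>: "R i powr \<delta> = \<beta> ^ k i" for i
    unfolding R_def \<beta>_def by (rule half_power_powr)

  have upper: "(\<Sum>i. ennreal (w i) * indicator (U i) z) \<le> ennreal (1 / (1 - \<beta>)) * \<rho> z" for z
  proof -
    define T where "T = {i\<in>S. z \<in> U i}"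
    have "inj_on k T"
    proof (rule inj_onI, rule ccontr)
      fix i j assume ij: "i \<in> T" "j \<in> T" "k i = k j" "i \<noteq> j"
      then have "2 * R i \<le> dist (y i) (y j)"
        using pairwiseD[OF S(2), of i j] by (auto simp: T_def P_def)
      also have "\<dots> \<le> dist (y i) z + dist (y j) z" by (metis dist_commute dist_triangle)
      also have "\<dots> < R i + R j" using ij by (auto simp: T_def U_def intro: add_strict_mono)
      finally show False using ij(3) by (simp add: R_def)
    qed
    have "ennreal (w i) * indicator (U i) z \<le> ennreal (\<beta> ^ k i) * indicator T i * \<rho> z" for i
    proof (cases "i \<in> T")
      case True
      then have i: "i \<in> S" "i \<in> I" "z \<in> U i" using S(1) by (auto simp: T_def)
      then have ne: "A i \<inter> M \<noteq> {}" by (simp add: I_def)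
      have "dist (x i) z \<le> dist (x i) (y i) + dist (y i) z" by (rule dist_triangle)
      also have "\<dots> < 2 * R i"
        using diam[OF ne x[OF ne] y(1)[OF i(2)]] i(3) by (simp add: U_def)
      finally have *: "ennreal (D i powr \<alpha> * R i powr (- s - \<delta>)) \<le> \<rho> z"
        by (intro \<rho>_ge[OF ne]) simp
      have "w i = \<beta> ^ k i * (D i powr \<alpha> * R i powr (- s - \<delta>))"
        using i(1) R[of i] by (simp add: w_def R_\<delta>[symmetric] powr_diff)
      then have "ennreal (w i) = ennreal (\<beta> ^ k i) * ennreal (D i powr \<alpha> * R i powr (- s - \<delta>))"
        using \<beta>(1) by (simp add: ennreal_mult)
      also have "\<dots> \<le> ennreal (\<beta> ^ k i) * \<rho> z" using * by (rule mult_left_mono) simp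
      finally show ?thesis using True i(3) by simp
    next
      case False
      then show ?thesis by (auto simp: T_def w_def indicator_def)
    qed
    then have "(\<Sum>i. ennreal (w i) * indicator (U i) z) \<le> (\<Sum>i. ennreal (\<beta> ^ k i) * indicator T i * \<rho> z)"
      by (intro suminf_le summableI)
    also have "\<dots> = (\<Sum>i. ennreal (\<beta> ^ k i) * indicator T i) * \<rho> z"
      by (rule ennreal_suminf_multc)
    also have "\<dots> \<le> ennreal (1 / (1 - \<beta>)) * \<rho> z"
      using \<beta> \<open>inj_on k T\<close> by (intro mult_right_mono suminf_power_inj_le) auto
    finally show ?thesis .
  qed

  have "hausdorff_premeasure e \<alpha> top M
      \<le> (\<Sum>i. epowr (ediam e (if i \<in> S then ball (y i) (3 * R i) \<inter> M else {})) \<alpha>)"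
  proof (rule hausdorff_premeasure_le)
    have "z \<in> (\<Union>i. if i \<in> S then ball (y i) (3 * R i) \<inter> M else {})" if z: "z \<in> M" for z
    proof -
      obtain i where i: "z \<in> A i" using M z by blast
      then have iI: "i \<in> I" using z by (auto simp: I_def)
      then have ne: "A i \<inter> M \<noteq> {}" by (simp add: I_def)
      have zi: "dist (y i) z \<le> R i" by (rule diam[OF ne y(1)[OF iI] i])
      obtain j where j: "j \<in> S" "dist (y j) z < 3 * R j"
      proof (cases "i \<in> S")
        case True
        then show thesis using that[of i] zi R[of i] by simp
      next
        case False
        then obtain j where "j \<in> S" "k i = k j" "dist (y i) (y j) < 2 * R i"
          using max[OF iI] by (auto simp: P_def)
        moreover have "dist (y j) z \<le> dist (y i) (y j) + dist (y i) z"
          by (metis dist_commute dist_triangle)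
        ultimately show thesis using that[of j] zi by (simp add: R_def)
      qed
      then show ?thesis using z by (intro UN_I[of j]) auto
    qed
    then show "(\<Union>i. if i \<in> S then ball (y i) (3 * R i) \<inter> M else {}) = M"
      by (auto split: if_splits)
  qed simp
  also have "\<dots> \<le> (\<Sum>i. ennreal (C powr \<alpha>) * ennreal (D i powr \<alpha> * indicator S i))"
  proof (intro suminf_le summableI)
    fix i
    show "epowr (ediam e (if i \<in> S then ball (y i) (3 * R i) \<inter> M else {})) \<alpha>
        \<le> ennreal (C powr \<alpha>) * ennreal (D i powr \<alpha> * indicator S i)"
    proof (cases "i \<in> S")
      case True
      then have iI: "i \<in> I" using S(1) by blast
      have "ediam e (ball (y i) (3 * R i) \<inter> M) \<le> ediam e (ball (y i) (3 * R i))"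
        unfolding ediam_def by (intro SUP_subset_mono) auto
      also have "\<dots> \<le> ennreal (C * D i)"
        using iI y(1)[OF iI] by (intro image_diam) (auto simp: I_def)
      finally have "epowr (ediam e (ball (y i) (3 * R i) \<inter> M)) \<alpha> \<le> epowr (ennreal (C * D i)) \<alpha>"
        using \<alpha> by (intro epowr_mono) auto
      also have "\<dots> = ennreal (C powr \<alpha>) * ennreal (D i powr \<alpha>)"
        using C D[of i] by (subst epowr_ennreal) (auto simp: powr_mult ennreal_mult)
      finally show ?thesis using True by simp
    qed (simp add: ediam_def bot_ennreal)
  qed
  also have "\<dots> = ennreal (C powr \<alpha>) * (\<Sum>i. ennreal (D i powr \<alpha> * indicator S i))"
    by (rule ennreal_suminf_cmult)
  finally have content: "hausdorff_premeasure e \<alpha> top M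
      \<le> ennreal (C powr \<alpha>) * (\<Sum>i. ennreal (D i powr \<alpha> * indicator S i))" .

  have "ennreal C1 * (\<Sum>i. ennreal (D i powr \<alpha> * indicator S i))
      = (\<Sum>i. ennreal C1 * ennreal (D i powr \<alpha> * indicator S i))"
    by (rule ennreal_suminf_cmult[symmetric])
  also have "\<dots> \<le> (\<Sum>i. ennreal (w i) * emeasure \<nu> (U i))"
  proof (intro suminf_le summableI)
    fix i
    show "ennreal C1 * ennreal (D i powr \<alpha> * indicator S i) \<le> ennreal (w i) * emeasure \<nu> (U i)"
    proof (cases "i \<in> S")
      case True
      then have iI: "i \<in> I" using S(1) by blast
      have "C1 * D i powr \<alpha> = w i * (C1 * R i powr s)"
        using True R[of i] by (simp add: w_def powr_minus)
      then have "ennreal C1 * ennreal (D i powr \<alpha> * indicator S i) = ennreal (w i) * ennreal (C1 * R i powr s)"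
        using True C1 w0[of i] by (simp flip: ennreal_mult)
      also have "\<dots> \<le> ennreal (w i) * emeasure \<nu> (U i)"
        unfolding U_def using iI y(2)[OF iI] by (intro mult_left_mono mass) (auto simp: I_def)
      finally show ?thesis .
    qed simp
  qed
  also have "\<dots> = (\<Sum>i. \<integral>\<^sup>+z. ennreal (w i) * indicator (U i) z \<partial>\<nu>)"
    by (simp add: nn_integral_cmult_indicator)
  also have "\<dots> = (\<integral>\<^sup>+z. (\<Sum>i. ennreal (w i) * indicator (U i) z) \<partial>\<nu>)"
    by (rule nn_integral_suminf[symmetric]) measurable
  also have "\<dots> \<le> (\<integral>\<^sup>+z. ennreal (1 / (1 - \<beta>)) * \<rho> z \<partial>\<nu>)"
    by (intro nn_integral_mono upper)
  also have "\<dots> = ennreal (1 / (1 - \<beta>)) * (\<integral>\<^sup>+z. \<rho> z \<partial>\<nu>)"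
    by (intro nn_integral_cmult borel_measurable_finer[OF \<rho> \<nu>])
  finally have mass_le: "ennreal C1 * (\<Sum>i. ennreal (D i powr \<alpha> * indicator S i))
      \<le> ennreal (1 / (1 - \<beta>)) * (\<integral>\<^sup>+z. \<rho> z \<partial>\<nu>)" .

  have "ennreal (C1 * C powr (- \<alpha>) * (1 - \<beta>)) * hausdorff_premeasure e \<alpha> top M
      \<le> ennreal (C1 * C powr (- \<alpha>) * (1 - \<beta>)) *
         (ennreal (C powr \<alpha>) * (\<Sum>i. ennreal (D i powr \<alpha> * indicator S i)))"
    by (rule mult_left_mono[OF content]) simp
  also have "\<dots> = ennreal (1 - \<beta>) * (ennreal C1 * (\<Sum>i. ennreal (D i powr \<alpha> * indicator S i)))"
  proof -
    have "C1 * C powr (- \<alpha>) * (1 - \<beta>) * C powr \<alpha> = (1 - \<beta>) * C1"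
      using C by (simp add: powr_minus)
    then have "ennreal (C1 * C powr (- \<alpha>) * (1 - \<beta>)) * ennreal (C powr \<alpha>) = ennreal (1 - \<beta>) * ennreal C1"
      using C1 \<beta> by (simp flip: ennreal_mult)
    then show ?thesis by (simp only: mult.assoc[symmetric])
  qed
  also have "\<dots> \<le> ennreal (1 - \<beta>) * (ennreal (1 / (1 - \<beta>)) * (\<integral>\<^sup>+z. \<rho> z \<partial>\<nu>))"
    by (rule mult_left_mono[OF mass_le]) simp
  also have "\<dots> = (\<integral>\<^sup>+z. \<rho> z \<partial>\<nu>)"
  proof -
    have "ennreal (1 - \<beta>) * ennreal (1 / (1 - \<beta>)) = 1"
      using \<beta> by (simp flip: ennreal_mult)
    then show ?thesis by (simp only: mult.assoc[symmetric] mult_1_left)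
  qed
  finally show ?thesis unfolding \<beta>_def .
qed

text \<open>
  The test function of a cover: each set of the cover contributes the constant
  \<open>D i powr (t / p') * R i powr - (q / p')\<close> on a ball of its scale, and the contributions are combined
  in the \<open>p'\<close>-norm. The upper mass bound then makes the \<open>p'\<close>-energy at most a multiple of the cost
  of the cover, and a small \<open>p'\<close>-energy on a bounded set means a small \<open>p\<close>-energy. The excess of
  \<open>q / p'\<close> over the exponent \<open>s\<close> of the lower mass bound pays for the overlap of different scales.
  The constant \<open>c\<close> does not depend on the energy \<open>\<epsilon>\<close>.
\<close>
lemma small_energy_test_functions:
  fixes \<mu> :: "'a measure" and a :: 'a
  assumes \<mu>: "sets borel \<subseteq> sets \<mu>"
    and t: "0 < t" and p: "0 < p" "p < p'" and s: "s < q / p'"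
    and null: "hausdorff_measure e t UNIV = 0"
    and r0: "0 < r0" "r0 \<le> 1"
    and G: "G \<subseteq> ball a r" and finite: "emeasure \<mu> (ball a (r + 1)) < top"
    and C0: "0 < C0"
    and upper: "\<And>x \<sigma>. x \<in> G \<Longrightarrow> 0 < \<sigma> \<Longrightarrow> \<sigma> < r0 \<Longrightarrow> emeasure \<mu> (ball x \<sigma>) \<le> ennreal (C0 * \<sigma> powr q)"
    and C1: "0 < C1" and m: "0 < m"
  shows "\<exists>c>0. \<forall>\<epsilon>>0. \<exists>\<rho>\<in>borel_measurable borel. (\<integral>\<^sup>+x. epowr (\<rho> x) p \<partial>\<mu>) \<le> ennreal \<epsilon> \<and>
    (\<forall>\<nu> M. sets borel \<subseteq> sets \<nu> \<longrightarrow> M \<subseteq> G \<longrightarrow>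
       (\<forall>x\<in>M. \<forall>\<sigma>. 0 < \<sigma> \<and> \<sigma> < r0 \<longrightarrow> ennreal (C1 * \<sigma> powr s) \<le> emeasure \<nu> (ball x \<sigma>)) \<longrightarrow>
       ennreal m \<le> hausdorff_premeasure e (t / p') top M \<longrightarrow> ennreal c \<le> (\<integral>\<^sup>+x. \<rho> x \<partial>\<nu>))"
proof -
  have p': "0 < p'" using p by simp
  obtain C where C: "1 \<le> C" and cover: "\<And>p r k0 \<epsilon>. 0 < \<epsilon> \<Longrightarrow>
     \<exists>(A :: nat \<Rightarrow> 'a set) D k. (\<Union>i. A i) = UNIV \<and>
     (\<forall>i. 0 < D i) \<and> (\<Sum>i. ennreal (D i powr t)) \<le> ennreal \<epsilon> \<and>
     (\<forall>i. A i \<inter> ball p r \<noteq> {} \<longrightarrow> k0 \<le> k i \<and> (\<forall>u\<in>A i. \<forall>v\<in>A i. dist u v \<le> (1/2)^k i) \<and>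
        (\<forall>y\<in>A i. ediam e (ball y (3 * (1/2)^k i)) \<le> ennreal (C * D i)))"
    using scaled_cover[OF t null] by metis
  define \<delta> where "\<delta> = q / p' - s"
  have \<delta>: "0 < \<delta>" using s by (simp add: \<delta>_def)
  define L where "L = C1 * C powr (- (t / p')) * (1 - (1/2) powr \<delta>)"
  have L: "0 < L" using C1 C \<delta> powr_less_mono2[of \<delta> "1/2" 1] by (simp add: L_def)
  obtain k0 where k0: "(1/2::real)^k0 < r0 / 2"
    using real_arch_pow_inv[of "r0 / 2" "1/2"] r0 by auto
  have ball_sets: "ball x \<sigma> \<in> sets \<mu>" for x \<sigma> using \<mu> by auto
  have "\<exists>\<rho>\<in>borel_measurable borel. (\<integral>\<^sup>+x. epowr (\<rho> x) p \<partial>\<mu>) \<le> ennreal \<epsilon> \<and>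
    (\<forall>\<nu> M. sets borel \<subseteq> sets \<nu> \<longrightarrow> M \<subseteq> G \<longrightarrow>
       (\<forall>x\<in>M. \<forall>\<sigma>. 0 < \<sigma> \<and> \<sigma> < r0 \<longrightarrow> ennreal (C1 * \<sigma> powr s) \<le> emeasure \<nu> (ball x \<sigma>)) \<longrightarrow>
       ennreal m \<le> hausdorff_premeasure e (t / p') top M \<longrightarrow> ennreal (L * m) \<le> (\<integral>\<^sup>+x. \<rho> x \<partial>\<nu>))"
    if \<epsilon>: "0 < \<epsilon>" for \<epsilon>
  proof -
    obtain \<kappa> where \<kappa>: "0 < \<kappa>" and small: "\<And>\<psi>. \<psi> \<in> borel_measurable \<mu> \<Longrightarrow>
        (\<And>x. x \<notin> ball a (r + 1) \<Longrightarrow> \<psi> x = 0) \<Longrightarrow> (\<integral>\<^sup>+x. \<psi> x \<partial>\<mu>) \<le> ennreal \<kappa> \<Longrightarrow>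
        (\<integral>\<^sup>+x. epowr (\<psi> x) (p / p') \<partial>\<mu>) \<le> ennreal \<epsilon>"
      using small_integral_epowr[of "p / p'" "ball a (r + 1)" \<mu> \<epsilon>] p p' ball_sets finite \<epsilon> by auto
    have "0 < \<kappa> / (C0 * 2 powr q)" using \<kappa> C0 by simp
    from cover[OF this, of a r k0] obtain A :: "nat \<Rightarrow> 'a set" and D k
      where A: "(\<Union>i. A i) = UNIV" and D: "\<And>i. 0 < D i"
        and sum: "(\<Sum>i. ennreal (D i powr t)) \<le> ennreal (\<kappa> / (C0 * 2 powr q))"
        and scale: "\<And>i. A i \<inter> ball a r \<noteq> {} \<longrightarrow> k0 \<le> k i \<and> (\<forall>u\<in>A i. \<forall>v\<in>A i. dist u v \<le> (1/2)^k i) \<and>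
          (\<forall>y\<in>A i. ediam e (ball y (3 * (1/2)^k i)) \<le> ennreal (C * D i))"
      by metis
    define R where "R i = (1/2::real) ^ k i" for i
    have R: "0 < R i" for i by (simp add: R_def)
    define I where "I = {i. A i \<inter> G \<noteq> {}}"
    have I: "k0 \<le> k i" "\<And>u v. u \<in> A i \<Longrightarrow> v \<in> A i \<Longrightarrow> dist u v \<le> R i"
      "\<And>y. y \<in> A i \<Longrightarrow> ediam e (ball y (3 * R i)) \<le> ennreal (C * D i)" if "i \<in> I" for i
    proof -
      have "A i \<inter> ball a r \<noteq> {}" using that G by (auto simp: I_def)
      with scale[of i] show "k0 \<le> k i" "\<And>u v. u \<in> A i \<Longrightarrow> v \<in> A i \<Longrightarrow> dist u v \<le> R i"
        "\<And>y. y \<in> A i \<Longrightarrow> ediam e (ball y (3 * R i)) \<le> ennreal (C * D i)"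
        unfolding R_def by blast+
    qed
    have R_small: "2 * R i < r0" if "i \<in> I" for i
    proof -
      have "R i \<le> (1/2)^k0" unfolding R_def using I(1)[OF that] by (intro power_decreasing) auto
      then show ?thesis using k0 by linarith
    qed
    have "\<exists>y. i \<in> I \<longrightarrow> y \<in> A i \<and> y \<in> G" for i by (auto simp: I_def)
    then obtain x where x: "\<And>i. i \<in> I \<Longrightarrow> x i \<in> A i" "\<And>i. i \<in> I \<Longrightarrow> x i \<in> G"
      by metis
    define b where "b i = D i powr t * R i powr (- q) * indicator I i" for i
    have b0: "0 \<le> b i" for i by (simp add: b_def)
    \<comment> \<open>The radius \<open>2 * R i\<close> is large enough for \<open>ball (x i) (2 * R i)\<close> to contain \<open>ball y (R i)\<close> for all
      \<open>y \<in> A i\<close>: the test function must not depend on the set \<open>M\<close>, in which \<open>y\<close> is chosen.\<close>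
    define \<psi> where "\<psi> z = (\<Sum>i. ennreal (b i) * indicator (ball (x i) (2 * R i)) z)" for z
    have [measurable]: "ball (x i) (2 * R i) \<in> sets borel" for i by simp
    have \<psi>[measurable]: "\<psi> \<in> borel_measurable borel"
      unfolding \<psi>_def by measurable
    define \<rho> where "\<rho> z = epowr (\<psi> z) (1 / p')" for z
    have \<rho>[measurable]: "\<rho> \<in> borel_measurable borel"
      unfolding \<rho>_def by measurable

    have energy: "(\<integral>\<^sup>+z. epowr (\<rho> z) p \<partial>\<mu>) \<le> ennreal \<epsilon>"
    proof -
      have off: "\<psi> z = 0" if "z \<notin> ball a (r + 1)" for z
      proof -
        have "ennreal (b i) * indicator (ball (x i) (2 * R i)) z = 0" for i
        proof (cases "i \<in> I")
          case True
          have "z \<notin> ball (x i) (2 * R i)"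
          proof
            assume "z \<in> ball (x i) (2 * R i)"
            moreover have "x i \<in> ball a r" using x(2)[OF True] G by blast
            moreover have "dist a z \<le> dist a (x i) + dist (x i) z" by (rule dist_triangle)
            ultimately show False using that R_small[OF True] r0(2) by simp
          qed
          then show ?thesis by simp
        qed (simp add: b_def)
        then show ?thesis unfolding \<psi>_def by (simp only: suminf_zero)
      qed
      have "(\<integral>\<^sup>+z. \<psi> z \<partial>\<mu>) = (\<Sum>i. \<integral>\<^sup>+z. ennreal (b i) * indicator (ball (x i) (2 * R i)) z \<partial>\<mu>)"
        unfolding \<psi>_def
        by (intro nn_integral_suminf borel_measurable_finer[OF _ \<mu>]) measurable
      also have "\<dots> = (\<Sum>i. ennreal (b i) * emeasure \<mu> (ball (x i) (2 * R i)))"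
        by (simp add: nn_integral_cmult_indicator ball_sets)
      also have "\<dots> \<le> (\<Sum>i. ennreal (C0 * 2 powr q) * ennreal (D i powr t))"
      proof (intro suminf_le summableI)
        fix i
        show "ennreal (b i) * emeasure \<mu> (ball (x i) (2 * R i)) \<le> ennreal (C0 * 2 powr q) * ennreal (D i powr t)"
        proof (cases "i \<in> I")
          case True
          have "ennreal (b i) * emeasure \<mu> (ball (x i) (2 * R i)) \<le> ennreal (b i) * ennreal (C0 * (2 * R i) powr q)"
            using upper[OF x(2)[OF True]] R[of i] R_small[OF True] by (intro mult_left_mono) auto
          also have "\<dots> = ennreal (b i * (C0 * (2 * R i) powr q))"
            using b0 C0 by (intro ennreal_mult[symmetric]) auto
          also have "b i * (C0 * (2 * R i) powr q) = C0 * 2 powr q * D i powr t"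
            using True R[of i] by (simp add: b_def powr_mult powr_minus)
          finally show ?thesis using C0 by (simp add: ennreal_mult)
        qed (simp add: b_def)
      qed
      also have "\<dots> = ennreal (C0 * 2 powr q) * (\<Sum>i. ennreal (D i powr t))"
        by (rule ennreal_suminf_cmult)
      also have "\<dots> \<le> ennreal (C0 * 2 powr q) * ennreal (\<kappa> / (C0 * 2 powr q))"
        by (rule mult_left_mono[OF sum]) simp
      also have "\<dots> = ennreal \<kappa>"
        using \<kappa> C0 by (simp flip: ennreal_mult)
      finally have "(\<integral>\<^sup>+z. epowr (\<psi> z) (p / p') \<partial>\<mu>) \<le> ennreal \<epsilon>"
        by (intro small borel_measurable_finer[OF \<psi> \<mu>] off)
      then show ?thesis by (simp add: \<rho>_def epowr_epowr)
    qed

    have large: "ennreal (L * m) \<le> (\<integral>\<^sup>+x. \<rho> x \<partial>\<nu>)"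
      if \<nu>: "sets borel \<subseteq> sets \<nu>" and M: "M \<subseteq> G"
        and mass: "\<And>x \<sigma>. x \<in> M \<Longrightarrow> 0 < \<sigma> \<Longrightarrow> \<sigma> < r0 \<Longrightarrow> ennreal (C1 * \<sigma> powr s) \<le> emeasure \<nu> (ball x \<sigma>)"
        and content: "ennreal m \<le> hausdorff_premeasure e (t / p') top M" for \<nu> M
    proof -
      have MI: "i \<in> I" if "A i \<inter> M \<noteq> {}" for i using that M by (auto simp: I_def)
      have \<rho>_ge: "ennreal (D i powr (t / p') * R i powr (- s - \<delta>)) \<le> \<rho> z"
        if i: "i \<in> I" and z: "z \<in> ball (x i) (2 * R i)" for i z
      proof -
        have "ennreal (b i) * indicator (ball (x i) (2 * R i)) z \<le> \<psi> z"
          unfolding \<psi>_def by (rule le_suminf_ennreal)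
        then have "ennreal (b i) \<le> \<psi> z" using z by simp
        then have "epowr (ennreal (b i)) (1 / p') \<le> \<rho> z"
          unfolding \<rho>_def using p' by (intro epowr_mono) auto
        moreover have "b i powr (1 / p') = D i powr (t / p') * R i powr (- s - \<delta>)"
          using i p' by (simp add: b_def \<delta>_def powr_mult powr_powr)
        ultimately show ?thesis using b0 by (simp add: epowr_ennreal)
      qed
      have "ennreal (L * m) = ennreal L * ennreal m"
        using L m by (intro ennreal_mult) auto
      also have "\<dots> \<le> ennreal L * hausdorff_premeasure e (t / p') top M"
        by (rule mult_left_mono[OF content]) simp
      also have "\<dots> \<le> (\<integral>\<^sup>+x. \<rho> x \<partial>\<nu>)"
        unfolding L_def
      proof (rule integral_ge_content[of \<nu> \<rho> \<delta> "t / p'" C C1 D M A x k s])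
        show "0 < t / p'" using t p' by simp
        show "M \<subseteq> (\<Union>i. A i)" using A by simp
        fix i assume "A i \<inter> M \<noteq> {}"
        then have i: "i \<in> I" by (rule MI)
        show "x i \<in> A i" by (rule x(1)[OF i])
        show "dist u v \<le> (1/2)^k i" if "u \<in> A i" "v \<in> A i" for u v
          using I(2)[OF i that] by (simp add: R_def)
        show "ediam e (ball y (3 * (1/2)^k i)) \<le> ennreal (C * D i)" if "y \<in> A i" for y
          using I(3)[OF i that] by (simp add: R_def)
        show "ennreal (C1 * ((1/2)^k i) powr s) \<le> emeasure \<nu> (ball y ((1/2)^k i))" if "y \<in> M" for y
        proof -
          have "R i < r0" using R_small[OF i] R[of i] by linarith
          with mass[OF that R[of i]] show ?thesis by (simp add: R_def)
        qed
        show "ennreal (D i powr (t / p') * ((1/2)^k i) powr (- s - \<delta>)) \<le> \<rho> z"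
          if "z \<in> ball (x i) (2 * (1/2)^k i)" for z
          using \<rho>_ge[OF i] that unfolding R_def by blast
      qed (use \<nu> \<rho> \<delta> C C1 D in auto)
      finally show ?thesis .
    qed
    show ?thesis
    proof (intro bexI[of _ \<rho>] conjI allI impI energy \<rho>)
      fix \<nu> M
      assume "sets borel \<subseteq> sets \<nu>" "M \<subseteq> G"
        and mass: "\<forall>x\<in>M. \<forall>\<sigma>. 0 < \<sigma> \<and> \<sigma> < r0 \<longrightarrow> ennreal (C1 * \<sigma> powr s) \<le> emeasure \<nu> (ball x \<sigma>)"
        and "ennreal m \<le> hausdorff_premeasure e (t / p') top M"
      then show "ennreal (L * m) \<le> (\<integral>\<^sup>+x. \<rho> x \<partial>\<nu>)"
        by (intro large) (use mass in auto)
    qed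
  qed
  then show ?thesis
    using L m by (intro exI[of _ "L * m"] conjI allI impI mult_pos_pos)
qed

end


section \<open>Pulling back quasisymmetric maps\<close>

lemma quasisymmetric_metric_pullback:
  fixes f :: "'a::metric_space \<Rightarrow> 'b"
  assumes N: "Metric_space N e" and f: "quasisymmetric UNIV dist N e f"
  shows "quasisymmetric_metric (\<lambda>x y. e (f x) (f y))"
proof -
  let ?e = "\<lambda>x y. e (f x) (f y)"
  interpret N: Metric_space N e by (rule N)
  have h: "homeomorphic_map Met_TC.mtopology N.mtopology f"
    using f by (simp add: quasisymmetric_def)
  have im: "f ` UNIV = N" and inj: "inj f"
    using homeomorphic_imp_surjective_map[OF h] homeomorphic_imp_injective_map[OF h]
    by (simp_all add: N.topspace_mtopology)
  then have fN: "f x \<in> N" for x by blast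
  obtain \<eta> \<theta> :: "real \<Rightarrow> real" where \<eta>: "homeomorphism {0..} {0..} \<eta> \<theta>"
    and qs: "\<And>x y z. x \<noteq> z \<Longrightarrow> ?e x y / ?e x z \<le> \<eta> (dist x y / dist x z)"
    using f by (auto simp: quasisymmetric_def)
  show ?thesis
  proof
    fix x y z
    show "0 \<le> ?e x y" "?e x y = ?e y x" by (simp_all add: N.commute)
    show "?e x y = 0 \<longleftrightarrow> x = y"
      using fN inj by (simp add: inj_eq)
    show "?e x z \<le> ?e x y + ?e y z" by (intro N.triangle fN)
  next
    fix x and \<epsilon> :: real assume \<epsilon>: "0 < \<epsilon>"
    have "continuous_map Met_TC.mtopology N.mtopology f"
      using h by (rule homeomorphic_imp_continuous_map)
    then show "\<exists>\<delta>>0. \<forall>y. dist x y < \<delta> \<longrightarrow> ?e x y < \<epsilon>"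
      using \<epsilon> unfolding Met_TC.metric_continuous_map[OF N] by auto
  next
    fix c :: real
    have "compact (\<eta> ` {0..c})"
      using \<eta> by (intro compact_continuous_image) (auto simp: homeomorphism_def elim: continuous_on_subset)
    then obtain K where K: "\<And>t. t \<in> {0..c} \<Longrightarrow> \<eta> t \<le> K"
      by (meson bdd_above.unfold bounded_imp_bdd_above compact_imp_bounded imageI)
    have "?e x y \<le> K * ?e x z" if le: "dist x y \<le> c * dist x z" for x y z
    proof (cases "x = z")
      case True
      then have "x = y" using le by simp
      then show ?thesis using True fN by simp
    next
      case False
      then have pos: "0 < ?e x z" using fN inj N.mdist_pos_eq[of "f x" "f z"] by (simp add: inj_eq)
      have "dist x y / dist x z \<in> {0..c}" using le False by (simp add: divide_le_eq)
      then have "?e x y / ?e x z \<le> K" using qs[OF False, of y] K by (meson order_trans)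
      then show ?thesis using pos by (simp add: divide_le_eq)
    qed
    then show "\<exists>K. \<forall>x y z. dist x y \<le> c * dist x z \<longrightarrow> ?e x y \<le> K * ?e x z" by blast
  qed
qed

text \<open>A quasisymmetric map of the whole space restricts to every subset.\<close>
lemma conformal_dim_subset_le:
  fixes f :: "'a::metric_space \<Rightarrow> 'b"
  assumes N: "Metric_space N e" and f: "quasisymmetric UNIV dist N e f"
  shows "conformal_dim E dist \<le> hausdorff_dim E (\<lambda>x y. e (f x) (f y))"
proof -
  let ?e = "\<lambda>x y. e (f x) (f y)"
  interpret Q: quasisymmetric_metric ?e by (rule quasisymmetric_metric_pullback[OF N f])
  interpret D: Metric_space E "dist :: 'a \<Rightarrow> 'a \<Rightarrow> real" by (rule Met_TC.subspace) simp
  interpret E: Metric_space E ?e by (rule Q.subspace) simp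
  have "continuous_map D.mtopology E.mtopology id"
    unfolding D.metric_continuous_map[OF E.Metric_space_axioms] using Q.continuous by (auto, meson)
  moreover have "continuous_map E.mtopology D.mtopology id"
    unfolding E.metric_continuous_map[OF D.Metric_space_axioms]
  proof (intro conjI ballI allI impI)
    fix x and \<epsilon> :: real assume "0 < \<epsilon>"
    then obtain \<tau> where "0 < \<tau>" "\<And>y. \<epsilon> \<le> dist x y \<Longrightarrow> \<tau> \<le> ?e x y"
      using Q.uniformly_far[of \<epsilon> x 1] by auto
    then show "\<exists>\<delta>>0. \<forall>y. y \<in> E \<and> ?e x y < \<delta> \<longrightarrow> dist (id x) (id y) < \<epsilon>"
      by (metis id_apply not_le)
  qed simp
  ultimately have "homeomorphic_map D.mtopology E.mtopology id"
    unfolding homeomorphic_map_maps homeomorphic_maps_def by (intro exI[of _ id]) simp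
  then have "quasisymmetric E dist E ?e id"
    using f by (auto simp: quasisymmetric_def)
  then show ?thesis
    by (rule conformal_dim_le[OF D.Metric_space_axioms E.Metric_space_axioms])
qed

lemma doubling_measure_finite_ball:
  fixes \<mu> :: "'a::metric_space measure"
  assumes \<mu>: "sets borel \<subseteq> sets \<mu>" and "doubling_measure \<mu>"
    and r: "0 < r" "emeasure \<mu> (ball x r) < top"
  shows "emeasure \<mu> (ball x R) < top"
proof -
  obtain C where C: "\<And>r. 0 < r \<Longrightarrow> emeasure \<mu> (ball x r) \<le> ennreal C * emeasure \<mu> (ball x (r / 2))"
    using assms(2) unfolding doubling_measure_def by blast
  have fin: "emeasure \<mu> (ball x (2 ^ n * r)) < top" for n :: nat
  proof (induction n)
    case (Suc n)
    have "emeasure \<mu> (ball x (2 ^ Suc n * r)) \<le> ennreal C * emeasure \<mu> (ball x (2 ^ n * r))"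
      using C[of "2 ^ Suc n * r"] r(1) by simp
    also have "\<dots> < top" using Suc by (simp add: ennreal_mult_less_top)
    finally show ?case .
  qed (simp add: r(2))
  obtain n where "R / r < 2 ^ n" using real_arch_pow[of 2 "R / r"] by auto
  then have "ball x R \<subseteq> ball x (2 ^ n * r)"
    using r(1) by (intro subset_ball) (simp add: divide_less_eq)
  then have "emeasure \<mu> (ball x R) \<le> emeasure \<mu> (ball x (2 ^ n * r))"
    using \<mu> by (intro emeasure_mono) auto
  with fin show ?thesis by (rule le_less_trans[rotated])
qed


section \<open>The lower bound for the conformal dimension\<close>

theorem theorem3p2:
  fixes \<mu> :: "'a::metric_space measure"
    and q p :: real
    and \<E> :: "'a set set"
    and lam :: "'a set \<Rightarrow> 'a measure"
  assumes borel: "sets borel \<subseteq> sets \<mu>"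
    and doubling: "doubling_measure \<mu>"
    and upper_mass: "\<exists>C>0. \<forall>x. \<exists>r0>0. \<forall>r. 0 < r \<and> r < r0 \<longrightarrow>
          emeasure \<mu> (ball x r) \<le> ennreal (C * r powr q)"
    and domain: "\<And>E. E \<in> \<E> \<Longrightarrow> sets \<mu> \<subseteq> sets (lam E)"
    and supported: "\<And>E. E \<in> \<E> \<Longrightarrow> E \<in> sets (lam E) \<and> emeasure (lam E) (- E) = 0"
    and cdim: "\<And>E. E \<in> \<E> \<Longrightarrow> 1 \<le> conformal_dim E dist"
    and lower_mass: "\<And>s. 1 < s \<Longrightarrow>
          \<exists>C1>0. \<forall>x. \<exists>r1>0. \<forall>E\<in>\<E>. x \<in> E \<longrightarrow> (\<forall>r. 0 < r \<and> r < r1 \<longrightarrow>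
            ennreal (C1 * r powr s) \<le> emeasure (lam E) (ball x r \<inter> E))"
    and p: "1 \<le> p" "p < q"
    and modulus: "fuglede_modulus p \<mu> (lam ` \<E>) > 0"
  shows "ennreal q \<le> conformal_dim (UNIV :: 'a set) dist"
proof (rule ccontr)
  assume "\<not> ?thesis"
  then obtain N :: "'a set" and e0 and f :: "'a \<Rightarrow> 'a" where N: "Metric_space N e0"
    and f: "quasisymmetric UNIV dist N e0 f" and dimN: "hausdorff_dim N e0 < ennreal q"
    unfolding conformal_dim_def by (auto simp: not_le Inf_less_iff)
  define e where "e x y = e0 (f x) (f y)" for x y
  have e_eq: "e = (\<lambda>x y. e0 (f x) (f y))" by (simp add: e_def fun_eq_iff)
  interpret quasisymmetric_metric e
    unfolding e_eq by (rule quasisymmetric_metric_pullback[OF N f])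
  have "f ` UNIV = N"
    using f homeomorphic_imp_surjective_map
    by (fastforce simp: quasisymmetric_def Metric_space.topspace_mtopology[OF N])
  then have "hausdorff_dim UNIV e < ennreal q"
    using dimN hausdorff_dim_pullback_le[of f UNIV N e0] unfolding e_eq by simp
  then obtain t where t: "0 < t" "t < q" and null: "hausdorff_measure e t UNIV = 0"
    using p by (auto simp: hausdorff_dim_def Inf_less_iff ennreal_less_iff)

  \<comment> \<open>As \<open>p'\<close> exceeds \<open>t\<close> and is less than \<open>q\<close>, \<open>\<alpha> = t / p'\<close> is below the dimension of the sets
    in \<open>\<E>\<close>, and there is an exponent \<open>s > 1\<close> below \<open>q / p'\<close>.\<close>
  define p' where "p' = (max t p + q) / 2"
  have p': "t < p'" "p < p'" "p' < q" "0 < p'" using t p by (auto simp: p'_def)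
  define s where "s = (1 + q / p') / 2"
  have s: "1 < s" "s < q / p'" using p' by (auto simp: s_def field_simps)
  define \<alpha> where "\<alpha> = t / p'"
  have \<alpha>: "0 < \<alpha>" "\<alpha> < 1" using t p' by (auto simp: \<alpha>_def)
  obtain C0 where C0: "0 < C0" and up: "\<And>x. \<exists>r0>0. \<forall>r. 0 < r \<and> r < r0 \<longrightarrow>
      emeasure \<mu> (ball x r) \<le> ennreal (C0 * r powr q)"
    using upper_mass by blast
  obtain C1 where C1: "0 < C1" and low: "\<And>x. \<exists>r1>0. \<forall>E\<in>\<E>. x \<in> E \<longrightarrow> (\<forall>r. 0 < r \<and> r < r1 \<longrightarrow>
      ennreal (C1 * r powr s) \<le> emeasure (lam E) (ball x r \<inter> E))"
    using lower_mass[OF s(1)] by blast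
  have lam_borel: "sets borel \<subseteq> sets (lam E)" if "E \<in> \<E>" for E
    using borel domain[OF that] by blast
  have finite: "emeasure \<mu> (ball x r) < top" for x r
  proof -
    obtain r0 where r0: "r0 > 0" "\<And>r. 0 < r \<Longrightarrow> r < r0 \<Longrightarrow> emeasure \<mu> (ball x r) \<le> ennreal (C0 * r powr q)"
      using up by blast
    have "emeasure \<mu> (ball x (r0 / 2)) \<le> ennreal (C0 * (r0 / 2) powr q)"
      using r0 by simp
    also have "\<dots> < top" by simp
    finally have "emeasure \<mu> (ball x (r0 / 2)) < top" .
    then show ?thesis
      using r0(1) by (simp add: doubling_measure_finite_ball[OF borel doubling, of "r0 / 2"])
  qed

  define a :: 'a where "a = undefined"
  \<comment> \<open>The bounded parts on which the mass bounds hold uniformly.\<close>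
  define G where "G n = {x \<in> ball a (real n). \<forall>r. 0 < r \<and> r < 1 / real (Suc n) \<longrightarrow>
      emeasure \<mu> (ball x r) \<le> ennreal (C0 * r powr q) \<and>
      (\<forall>E\<in>\<E>. x \<in> E \<longrightarrow> ennreal (C1 * r powr s) \<le> emeasure (lam E) (ball x r \<inter> E))}" for n
  have G: "\<exists>n. x \<in> G n" for x
  proof -
    obtain r0 where r0: "r0 > 0" "\<And>r. 0 < r \<Longrightarrow> r < r0 \<Longrightarrow> emeasure \<mu> (ball x r) \<le> ennreal (C0 * r powr q)"
      using up by blast
    obtain r1 where r1: "r1 > 0" "\<forall>E\<in>\<E>. x \<in> E \<longrightarrow> (\<forall>r. 0 < r \<and> r < r1 \<longrightarrow>
        ennreal (C1 * r powr s) \<le> emeasure (lam E) (ball x r \<inter> E))"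
      using low[of x] by (elim exE conjE)
    obtain n where n: "1 / real (Suc n) < min r0 r1"
      using r0(1) r1(1) nat_approx_posE[of "min r0 r1"] by (metis min_less_iff_conj)
    obtain n' where n': "dist a x < real n'" using reals_Archimedean2 by blast
    have "1 / real (Suc (max n n')) \<le> 1 / real (Suc n)" by (intro divide_left_mono) auto
    then have "x \<in> G (max n n')"
      using n n' r0(2) r1(2) unfolding G_def by auto
    then show ?thesis ..
  qed

  \<comment> \<open>The measures of the sets with a part in \<open>G n\<close> of content at least \<open>1 / Suc m\<close>; each \<open>j\<close> codes
    a pair \<open>(n, m)\<close>.\<close>
  define F where "F j = {lam E | E. E \<in> \<E> \<and>
      ennreal (1 / real (Suc (snd (prod_decode j))))
        \<le> hausdorff_premeasure e \<alpha> top (E \<inter> G (fst (prod_decode j)))}" for j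
  have "fuglede_modulus p \<mu> (lam ` \<E>) = 0"
  proof (rule fuglede_modulus_eq_0[where F = F])
    show "0 < p" using p by simp
    show "sets borel \<subseteq> sets \<mu>" by (rule borel)
    show "sets borel \<subseteq> sets \<nu>" if "\<nu> \<in> lam ` \<E>" for \<nu> using that lam_borel by blast
    show "\<exists>j. \<nu> \<in> F j" if "\<nu> \<in> lam ` \<E>" for \<nu>
    proof -
      from that obtain E where E: "E \<in> \<E>" "\<nu> = lam E" by blast
      have "1 \<le> hausdorff_dim E e"
        using cdim[OF E(1)] conformal_dim_subset_le[OF N f, of E] unfolding e_eq by (rule order_trans)
      have "hausdorff_measure e \<alpha> E \<noteq> 0"
      proof
        assume "hausdorff_measure e \<alpha> E = 0"
        then have "hausdorff_dim E e \<le> ennreal \<alpha>"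
          unfolding hausdorff_dim_def using \<alpha>(1) by (intro Inf_lower) auto
        also have "\<dots> < 1" using \<alpha> by (simp add: ennreal_less_one_iff)
        finally show False using \<open>1 \<le> hausdorff_dim E e\<close> by simp
      qed
      moreover have "(\<Union>n. E \<inter> G n) = E" using G by blast
      ultimately obtain n where n: "hausdorff_premeasure e \<alpha> top (E \<inter> G n) \<noteq> 0"
        using hausdorff_premeasure_UN_eq_0[of e \<alpha> top "\<lambda>n. E \<inter> G n"] hausdorff_measure_eq_0[OF \<alpha>(1)]
        by metis
      obtain m where m: "ennreal (1 / real (Suc m)) \<le> hausdorff_premeasure e \<alpha> top (E \<inter> G n)"
      proof (cases "hausdorff_premeasure e \<alpha> top (E \<inter> G n)" rule: ennreal_cases)
        case (real c)
        then have "0 < c" using n by (cases "c = 0") auto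
        then obtain m where "1 / real (Suc m) < c" by (rule nat_approx_posE)
        then show thesis using real that[of m] by (simp add: ennreal_leI)
      qed (use that in simp)
      have "\<nu> \<in> F (prod_encode (n, m))"
        unfolding F_def using E m by auto
      then show ?thesis ..
    qed
    show "\<exists>c>0. \<forall>\<epsilon>>0. \<exists>\<rho>\<in>borel_measurable borel. (\<integral>\<^sup>+x. epowr (\<rho> x) p \<partial>\<mu>) \<le> ennreal \<epsilon> \<and>
        (\<forall>\<nu>\<in>F j. ennreal c \<le> (\<integral>\<^sup>+x. \<rho> x \<partial>\<nu>))" for j
    proof -
      obtain n m where nm: "prod_decode j = (n, m)" by (cases "prod_decode j")
      obtain c where c: "0 < c" and test: "\<And>\<epsilon>. 0 < \<epsilon> \<Longrightarrow> \<exists>\<rho>\<in>borel_measurable borel.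
          (\<integral>\<^sup>+x. epowr (\<rho> x) p \<partial>\<mu>) \<le> ennreal \<epsilon> \<and>
          (\<forall>\<nu> M. sets borel \<subseteq> sets \<nu> \<longrightarrow> M \<subseteq> G n \<longrightarrow>
             (\<forall>x\<in>M. \<forall>\<sigma>. 0 < \<sigma> \<and> \<sigma> < 1 / real (Suc n) \<longrightarrow>
                ennreal (C1 * \<sigma> powr s) \<le> emeasure \<nu> (ball x \<sigma>)) \<longrightarrow>
             ennreal (1 / real (Suc m)) \<le> hausdorff_premeasure e (t / p') top M \<longrightarrow>
             ennreal c \<le> (\<integral>\<^sup>+x. \<rho> x \<partial>\<nu>))"
      proof -
        have "0 < p" using p by auto
        moreover have "0 < 1 / real (Suc n)" "1 / real (Suc n) \<le> 1" "0 < 1 / real (Suc m)" by auto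
        moreover have "G n \<subseteq> ball a (real n)" by (auto simp: G_def)
        moreover have "emeasure \<mu> (ball x \<sigma>) \<le> ennreal (C0 * \<sigma> powr q)"
          if "x \<in> G n" "0 < \<sigma>" "\<sigma> < 1 / real (Suc n)" for x \<sigma>
          using that unfolding G_def by blast
        ultimately have "\<exists>c>0. \<forall>\<epsilon>>0. \<exists>\<rho>\<in>borel_measurable borel.
          (\<integral>\<^sup>+x. epowr (\<rho> x) p \<partial>\<mu>) \<le> ennreal \<epsilon> \<and>
          (\<forall>\<nu> M. sets borel \<subseteq> sets \<nu> \<longrightarrow> M \<subseteq> G n \<longrightarrow>
             (\<forall>x\<in>M. \<forall>\<sigma>. 0 < \<sigma> \<and> \<sigma> < 1 / real (Suc n) \<longrightarrow>
                ennreal (C1 * \<sigma> powr s) \<le> emeasure \<nu> (ball x \<sigma>)) \<longrightarrow>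
             ennreal (1 / real (Suc m)) \<le> hausdorff_premeasure e (t / p') top M \<longrightarrow>
             ennreal c \<le> (\<integral>\<^sup>+x. \<rho> x \<partial>\<nu>))"
          by (intro small_energy_test_functions[OF borel t(1) _ p'(2) s(2) null _ _ _ finite C0 _ C1])
        then show thesis using that by blast
      qed
      have "\<exists>\<rho>\<in>borel_measurable borel. (\<integral>\<^sup>+x. epowr (\<rho> x) p \<partial>\<mu>) \<le> ennreal \<epsilon> \<and>
          (\<forall>\<nu>\<in>F j. ennreal c \<le> (\<integral>\<^sup>+x. \<rho> x \<partial>\<nu>))" if "0 < \<epsilon>" for \<epsilon>
      proof -
        from test[OF that] obtain \<rho> where \<rho>: "\<rho> \<in> borel_measurable borel"
          "(\<integral>\<^sup>+x. epowr (\<rho> x) p \<partial>\<mu>) \<le> ennreal \<epsilon>"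
          and large: "\<And>\<nu> M. sets borel \<subseteq> sets \<nu> \<Longrightarrow> M \<subseteq> G n \<Longrightarrow>
             \<forall>x\<in>M. \<forall>\<sigma>. 0 < \<sigma> \<and> \<sigma> < 1 / real (Suc n) \<longrightarrow>
                ennreal (C1 * \<sigma> powr s) \<le> emeasure \<nu> (ball x \<sigma>) \<Longrightarrow>
             ennreal (1 / real (Suc m)) \<le> hausdorff_premeasure e (t / p') top M \<Longrightarrow>
             ennreal c \<le> (\<integral>\<^sup>+x. \<rho> x \<partial>\<nu>)"
          by metis
        have "ennreal c \<le> (\<integral>\<^sup>+x. \<rho> x \<partial>\<nu>)" if "\<nu> \<in> F j" for \<nu>
        proof -
          from that obtain E where E: "E \<in> \<E>" "\<nu> = lam E"
            and content: "ennreal (1 / real (Suc m)) \<le> hausdorff_premeasure e \<alpha> top (E \<inter> G n)"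
            unfolding F_def nm by auto
          have "ennreal (C1 * \<sigma> powr s) \<le> emeasure (lam E) (ball x \<sigma>)"
            if "x \<in> E \<inter> G n" "0 < \<sigma> \<and> \<sigma> < 1 / real (Suc n)" for x \<sigma>
          proof -
            have "ennreal (C1 * \<sigma> powr s) \<le> emeasure (lam E) (ball x \<sigma> \<inter> E)"
              using that E(1) unfolding G_def by blast
            also have "\<dots> \<le> emeasure (lam E) (ball x \<sigma>)"
              using lam_borel[OF E(1)] by (intro emeasure_mono) auto
            finally show ?thesis .
          qed
          then show ?thesis
            unfolding E(2) using content lam_borel[OF E(1)]
            by (intro large[of "lam E" "E \<inter> G n"]) (auto simp: \<alpha>_def)
        qed
        with \<rho> show ?thesis by blast
      qed
      with c show ?thesis by blast
    qed
  qed
  with modulus show False by simp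
qed

end
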